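(* Suppose $\kappa$ is an inaccessible cardinal that carries a $\kappa$-complete $\kappa$-saturated ideal. Then $HL(1,\delta,\kappa)$ holds for every $\delta<\kappa$, i.e., for every nice tree $T$ and every $f:T\to\delta$ there exists a strong subtree $T'\subseteq T$ on which $f$ is constant.
   Context: An ideal $I$ on $\kappa$ is taken to be proper ($\kappa\notin I$) and to contain all singletons; it is $\kappa$-complete if it is closed under unions of fewer than $\kappa$ members, and $\kappa$-saturated if $P(\kappa)/I$ has the $\kappa$-chain condition (every family of $I$-positive sets that are pairwise almost disjoint modulo $I$ has size $<\kappa$). Tree notions: $ht_T(t)$ order type of predecessors; $T(\alpha)$ level $\alpha$; $Succ_T(t)$ immediate successors. A nice tree: unique root; heights $<\kappa$ unbounded in $\kappa$, levels of size $<\kappa$; every maximal path of order type $\kappa$, at limit levels nodes with the same predecessors coincide; every node has two incomparable extensions. $T'\subseteq T$ is a strong subtree if $T'$ is nice and there is $A\in[\kappa]^\kappa$ with increasing enumeration $\langle a_\xi\rangle$ such that $T'(\xi)\subseteq T(a_\xi)$ and each immediate successor in $T$ of a node of $T'(\xi)$ has exactly one extension in $T'(\xi+1)$.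
   Formalization: In "nice tree", "every node has two incomparable extensions" is read as two incomparable immediate successors (for T and T'); with arbitrary extensions the claim fails, e.g. for a tree with at most one splitting node per level, coloured by whether a node splits. *)

theory Defs
  imports Main
begin

unbundle cardinal_syntax

text \<open>
  A cardinal \<open>\<kappa>\<close> is a relation with \<^term>\<open>Card_order \<kappa>\<close>. The ordinals below \<open>\<kappa>\<close> are
  the elements of its field, and the ordinal \<open>\<alpha>\<close> itself, as a set, is \<^term>\<open>underS \<kappa> \<alpha>\<close>.
  A tree is given by its reflexive order \<open>T\<close>; its nodes are \<^term>\<open>Field T\<close>, and
  \<^term>\<open>underS T t\<close> is the set of strict predecessors of \<open>t\<close>.
\<close>

section \<open>Inaccessible cardinals and ideals\<close>

definition inaccessible :: "'a rel \<Rightarrow> bool" where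
  "inaccessible \<kappa> \<longleftrightarrow>
     Card_order \<kappa> \<and> natLeq <o \<kappa> \<and> regularCard \<kappa> \<and>
     (\<forall>\<mu> :: 'a rel. Card_order \<mu> \<and> \<mu> <o \<kappa> \<longrightarrow> ctwo ^c \<mu> <o \<kappa>)"

definition ideal_on :: "'a set \<Rightarrow> 'a set set \<Rightarrow> bool" where
  "ideal_on K I \<longleftrightarrow>
     I \<subseteq> Pow K \<and> {} \<in> I \<and>
     (\<forall>X Y. X \<in> I \<and> Y \<subseteq> X \<longrightarrow> Y \<in> I) \<and>
     (\<forall>X Y. X \<in> I \<and> Y \<in> I \<longrightarrow> X \<union> Y \<in> I) \<and>
     K \<notin> I \<and> (\<forall>x\<in>K. {x} \<in> I)"

definition complete_ideal :: "'a rel \<Rightarrow> 'a set set \<Rightarrow> bool" where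
  "complete_ideal \<kappa> I \<longleftrightarrow> (\<forall>F. F \<subseteq> I \<and> |F| <o \<kappa> \<longrightarrow> \<Union>F \<in> I)"

definition saturated_ideal :: "'a rel \<Rightarrow> 'a set set \<Rightarrow> bool" where
  "saturated_ideal \<kappa> I \<longleftrightarrow>
     (\<forall>W. W \<subseteq> Pow (Field \<kappa>) - I \<and> (\<forall>X\<in>W. \<forall>Y\<in>W. X \<noteq> Y \<longrightarrow> X \<inter> Y \<in> I) \<longrightarrow> |W| <o \<kappa>)"

section \<open>Trees\<close>

definition tree :: "'b rel \<Rightarrow> bool" where
  "tree T \<longleftrightarrow>
     Partial_order T \<and> (\<forall>t\<in>Field T. Well_order (Restr T (underS T t)))"

text \<open>
  The height of a node is the order type of its predecessors. It is represented by the
  well-order on the predecessors, and compared up to isomorphism with the well-order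
  \<open>ord \<kappa> \<alpha>\<close> of the ordinal \<open>\<alpha>\<close>.
\<close>

definition ht :: "'b rel \<Rightarrow> 'b \<Rightarrow> 'b rel" where
  "ht T t = Restr T (underS T t)"

definition ord :: "'a rel \<Rightarrow> 'a \<Rightarrow> 'a rel" where
  "ord \<kappa> \<alpha> = Restr \<kappa> (underS \<kappa> \<alpha>)"

definition level :: "'a rel \<Rightarrow> 'b rel \<Rightarrow> 'a \<Rightarrow> 'b set" where
  "level \<kappa> T \<alpha> = {t \<in> Field T. ht T t =o ord \<kappa> \<alpha>}"

definition Succ :: "'b rel \<Rightarrow> 'b \<Rightarrow> 'b set" where
  "Succ T t = {s \<in> aboveS T t. aboveS T t \<inter> underS T s = {}}"

definition limit_ordinal :: "'a rel \<Rightarrow> 'a \<Rightarrow> bool" where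
  "limit_ordinal \<kappa> \<alpha> \<longleftrightarrow>
     \<alpha> \<in> Field \<kappa> \<and> underS \<kappa> \<alpha> \<noteq> {} \<and> (\<forall>\<beta>\<in>underS \<kappa> \<alpha>. wo_rel.suc \<kappa> {\<beta>} \<noteq> \<alpha>)"

definition maximal_path :: "'b rel \<Rightarrow> 'b set \<Rightarrow> bool" where
  "maximal_path T C \<longleftrightarrow> C \<in> Chains T \<and> (\<forall>D\<in>Chains T. C \<subseteq> D \<longrightarrow> D = C)"

text \<open>
  In the last clause, the two incomparable extensions of a node are immediate ones. Under the
  weaker condition that some two extensions are incomparable, a nice tree may have at most one
  node with several immediate successors on each level. Colour the nodes by whether they have
  several immediate successors. A monochromatic set of nodes with the successor property of a
  strong subtree is then a single path, so no strong subtree is monochromatic.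
\<close>

definition nice_tree :: "'a rel \<Rightarrow> 'b rel \<Rightarrow> bool" where
  "nice_tree \<kappa> T \<longleftrightarrow>
     tree T \<and>
     (\<exists>!t. t \<in> Field T \<and> underS T t = {}) \<and>
     (\<forall>t\<in>Field T. ht T t <o \<kappa>) \<and>
     (\<forall>\<alpha>\<in>Field \<kappa>. \<exists>t\<in>Field T. ord \<kappa> \<alpha> \<le>o ht T t) \<and>
     (\<forall>\<alpha>\<in>Field \<kappa>. |level \<kappa> T \<alpha>| <o \<kappa>) \<and>
     (\<forall>C. maximal_path T C \<longrightarrow> Restr T C =o \<kappa>) \<and>
     (\<forall>\<alpha>. limit_ordinal \<kappa> \<alpha> \<longrightarrow>
        (\<forall>s\<in>level \<kappa> T \<alpha>. \<forall>t\<in>level \<kappa> T \<alpha>. underS T s = underS T t \<longrightarrow> s = t)) \<and>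
     (\<forall>t\<in>Field T. \<exists>u\<in>Succ T t. \<exists>v\<in>Succ T t. (u, v) \<notin> T \<and> (v, u) \<notin> T)"

text \<open>
  The subtree is given by its set \<open>S\<close> of nodes, with the order inherited from \<open>T\<close>.
  The map \<open>a\<close> is the increasing enumeration of \<open>A\<close> in order type \<open>\<kappa>\<close>. Extensions are
  not required to be proper: if the levels \<open>a \<xi>\<close> and \<open>a (\<xi> + 1)\<close> are consecutive, the
  extension of \<open>u\<close> is \<open>u\<close> itself.
\<close>

definition strong_subtree :: "'a rel \<Rightarrow> 'b rel \<Rightarrow> 'b set \<Rightarrow> bool" where
  "strong_subtree \<kappa> T S \<longleftrightarrow>
     S \<subseteq> Field T \<and> nice_tree \<kappa> (Restr T S) \<and>
     (\<exists>A a. A \<subseteq> Field \<kappa> \<and> |A| =o \<kappa> \<and> iso \<kappa> (Restr \<kappa> A) a \<and>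
        (\<forall>\<xi>\<in>Field \<kappa>.
           level \<kappa> (Restr T S) \<xi> \<subseteq> level \<kappa> T (a \<xi>) \<and>
           (\<forall>s\<in>level \<kappa> (Restr T S) \<xi>. \<forall>u\<in>Succ T s.
              \<exists>!v. v \<in> level \<kappa> (Restr T S) (wo_rel.suc \<kappa> {\<xi>}) \<and> (u, v) \<in> T)))"

end

(* Let L(s, c) be the set of heights at which s has an extension of colour c.

   There are a positive set X, a node t and a colour c such that X - L(s, c) is null for every
   s above t. Otherwise, for every t and c, a maximal antichain of positive sets X that avoid
   L(s, c) for some s above t is a partition of \<kappa> modulo a null set, and it has fewer than \<kappa> pieces
   by saturation. It can be written as a map h from \<kappa> to the nodes above t, bounded in height,
   such that almost no \<alpha> belongs to L(h(\<alpha>), c). Composing these maps along the colours c < \<delta>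
   gives a bounded map g such that almost no \<alpha> belongs to any of the sets L(g(\<alpha>), c). But g(\<alpha>)
   has extensions at height \<alpha> for all large \<alpha>, and they have a colour.

   For such X, t and c, fewer than \<kappa> nodes above t have extensions of colour c at a common,
   arbitrarily large height. This is what is needed to build the strong subtree level by level. *)

theory Submission
  imports Defs
begin

text \<open>The maps must be bounded because their values depend on the height \<alpha>: only a node
  of height at most \<alpha> has extensions at height \<alpha>. Initial segments of \<kappa> are
  null, so a bound on the heights of the values secures this for almost every \<alpha>. This is the
  gain from saturation: the nodes attached to fewer than \<kappa> pieces are bounded in height by
  regularity. Composition keeps the bound because a level has fewer than \<kappa> nodes, so the maps
  chosen for all of its nodes have a common bound. At limit colours the earlier values form a chain
  for each \<alpha>, and niceness puts a node above it at a height that does not depend on \<alpha>.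
  Once \<open>X\<close> is found, completeness takes over: removing fewer than \<kappa> null sets
  leaves \<open>X\<close> positive, so a single height serves a whole level. Order types are
  compared only up to isomorphism, which is awkward for such arguments; hence heights are first
  turned into elements of \<open>Field \<kappa>\<close>.\<close>

lemma Restr_ordIso_image:
  assumes "Well_order \<kappa>" "inj_on f B" "f ` B \<subseteq> Field \<kappa>"
    and "\<And>a b. a \<in> B \<Longrightarrow> b \<in> B \<Longrightarrow> (a, b) \<in> R \<longleftrightarrow> (f a, f b) \<in> \<kappa>"
  shows "Restr R B =o Restr \<kappa> (f ` B)"
proof -
  have wo: "Well_order (Restr \<kappa> (f ` B))"
    using assms(1) by (rule Well_order_Restr)
  \<comment> \<open>The order is pulled back along the inverse of \<open>f\<close>: the known
    well-order is then the source of the isomorphism, and \<open>R\<close> inherits being a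
    well-order on \<open>B\<close>.\<close>
  have "Field (Restr \<kappa> (f ` B)) \<subseteq> f ` B"
    by (rule Field_Restr_subset)
  then have "inj_on (inv_into B f) (Field (Restr \<kappa> (f ` B)))"
    using inj_on_inv_into by blast
  from dir_image_ordIso[OF wo this]
  have "Restr \<kappa> (f ` B) =o dir_image (Restr \<kappa> (f ` B)) (inv_into B f)" .
  also have "dir_image (Restr \<kappa> (f ` B)) (inv_into B f) = Restr R B"
  proof (intro equalityI subrelI)
    fix a b
    assume "(a, b) \<in> dir_image (Restr \<kappa> (f ` B)) (inv_into B f)"
      then obtain x y where "(f x, f y) \<in> \<kappa>" "x \<in> B" "y \<in> B"
        "a = inv_into B f (f x)" "b = inv_into B f (f y)"
        unfolding dir_image_def by blast
      then show "(a, b) \<in> Restr R B" using assms(2,4) by simp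
    next
      fix a b
      assume "(a, b) \<in> Restr R B"
      then have "(f a, f b) \<in> Restr \<kappa> (f ` B)" "a = inv_into B f (f a)" "b = inv_into B f (f b)"
        using assms(2) assms(4)[of a b] by auto
      then show "(a, b) \<in> dir_image (Restr \<kappa> (f ` B)) (inv_into B f)"
        unfolding dir_image_def by blast
  qed
  finally show ?thesis by (rule ordIso_symmetric)
qed

text \<open>Niceness speaks about maximal paths only; through Zorn's lemma it also gives information
  about arbitrary chains, the empty one included.\<close>

lemma Chains_maximal_path:
  assumes "C \<in> Chains R"
  obtains M where "maximal_path R M" "C \<subseteq> M"
proof -
  let ?A = "{D \<in> Chains R. C \<subseteq> D}"
  have "\<exists>M\<in>?A. \<forall>X\<in>?A. M \<subseteq> X \<longrightarrow> X = M"
  proof (rule subset_Zorn_nonempty)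
    show "?A \<noteq> {}" using assms by auto
  next
    fix \<C> assume ne: "\<C> \<noteq> {}" and ch: "subset.chain ?A \<C>"
    have "(x, y) \<in> R \<or> (y, x) \<in> R" if "x \<in> X" "X \<in> \<C>" "y \<in> Y" "Y \<in> \<C>" for x y X Y
    proof -
      have "X \<subseteq> Y \<or> Y \<subseteq> X"
        using ch that unfolding subset.chain_def by blast
      moreover have "X \<in> Chains R" "Y \<in> Chains R"
        using ch that unfolding subset.chain_def by blast+
      ultimately show ?thesis
        using that unfolding Chains_def by blast
    qed
    moreover have "C \<subseteq> \<Union>\<C>"
      using ne ch unfolding subset.chain_def by blast
    ultimately show "\<Union>\<C> \<in> ?A"
      unfolding Chains_def by blast
  qed
  then obtain M where "M \<in> Chains R" "C \<subseteq> M" "\<And>X. X \<in> Chains R \<Longrightarrow> C \<subseteq> X \<Longrightarrow> M \<subseteq> X \<Longrightarrow> X = M"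
    by auto
  then show thesis
    using that[of M] unfolding maximal_path_def by blast
qed

text \<open>Greedy selection as well-founded recursion on the characteristic function: whether
  \<open>x\<close> is accepted depends only on the elements accepted before it. The set of levels of
  the subtree arises this way.\<close>

lemma well_founded_subset:
  fixes R :: "'a rel"
  assumes "wf R"
  obtains A where "\<And>x. x \<in> A \<longleftrightarrow> P x {y \<in> A. (y, x) \<in> R}"
proof -
  define H where "H F x = P x {y. F y \<and> (y, x) \<in> R}" for F x
  have adm: "adm_wf R H"
    unfolding adm_wf_def
  proof (intro allI impI)
    fix F G :: "'a \<Rightarrow> bool" and x
    assume "\<forall>z. (z, x) \<in> R \<longrightarrow> F z = G z"
    then have "{y. F y \<and> (y, x) \<in> R} = {y. G y \<and> (y, x) \<in> R}" by blast
    then show "H F x = H G x" unfolding H_def by (rule arg_cong)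
  qed
  define F where "F = wfrec R H"
  have "F = H F"
    unfolding F_def by (rule wfrec_fixpoint[OF assms adm])
  then have "F x = P x {y. F y \<and> (y, x) \<in> R}" for x
    using H_def[of F x] fun_cong[of F "H F" x] by argo
  then have "x \<in> {x. F x} \<longleftrightarrow> P x {y \<in> {x. F x}. (y, x) \<in> R}" for x
    unfolding mem_Collect_eq .
  then show thesis by (rule that)
qed

section \<open>Regular cardinals\<close>

locale regular_cardinal =
  fixes \<kappa> :: "'a rel"
  assumes Card_order: "Card_order \<kappa>"
    and natLeq_less: "natLeq <o \<kappa>"
    and regular: "regularCard \<kappa>"
begin

abbreviation le (infix "\<preceq>" 50) where "x \<preceq> y \<equiv> (x, y) \<in> \<kappa>"
abbreviation less (infix "\<prec>" 50) where "x \<prec> y \<equiv> x \<in> underS \<kappa> y"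

lemma Well_order: "Well_order \<kappa>"
  using Card_order by (simp add: card_order_on_def)

lemma wo_rel: "wo_rel \<kappa>"
  using Well_order by (simp add: wo_rel_def)

lemma le_Field: "x \<preceq> y \<Longrightarrow> x \<in> Field \<kappa>" "x \<preceq> y \<Longrightarrow> y \<in> Field \<kappa>"
  by (auto simp: Field_def)

lemma less_Field: "x \<prec> y \<Longrightarrow> x \<in> Field \<kappa>" "x \<prec> y \<Longrightarrow> y \<in> Field \<kappa>"
  by (auto simp: Field_def underS_def)

lemma le_refl: "x \<in> Field \<kappa> \<Longrightarrow> x \<preceq> x"
  using wo_rel.REFL[OF wo_rel] by (auto simp: refl_on_def)

lemma le_trans: "x \<preceq> y \<Longrightarrow> y \<preceq> z \<Longrightarrow> x \<preceq> z"
  using wo_rel.TRANS[OF wo_rel] by (auto dest: transD)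

lemma le_antisym: "x \<preceq> y \<Longrightarrow> y \<preceq> x \<Longrightarrow> x = y"
  using wo_rel.ANTISYM[OF wo_rel] by (auto dest: antisymD)

lemma less_irrefl: "\<not> x \<prec> x"
  by (simp add: underS_def)

lemma less_imp_le: "x \<prec> y \<Longrightarrow> x \<preceq> y"
  by (simp add: underS_def)

lemma le_less_trans: "x \<preceq> y \<Longrightarrow> y \<prec> z \<Longrightarrow> x \<prec> z"
  using le_trans le_antisym by (auto simp: underS_def)

lemma less_le_trans: "x \<prec> y \<Longrightarrow> y \<preceq> z \<Longrightarrow> x \<prec> z"
  using le_trans le_antisym by (auto simp: underS_def)

lemma less_trans: "x \<prec> y \<Longrightarrow> y \<prec> z \<Longrightarrow> x \<prec> z"
  using less_le_trans less_imp_le by blast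

lemma not_le: "x \<in> Field \<kappa> \<Longrightarrow> y \<in> Field \<kappa> \<Longrightarrow> \<not> x \<preceq> y \<longleftrightarrow> y \<prec> x"
  using wo_rel.TOTALS[OF wo_rel] le_refl le_antisym by (auto simp: underS_def)

lemma not_less: "x \<in> Field \<kappa> \<Longrightarrow> y \<in> Field \<kappa> \<Longrightarrow> \<not> x \<prec> y \<longleftrightarrow> y \<preceq> x"
  using not_le by blast

lemma le_iff_less_or_eq: "x \<in> Field \<kappa> \<Longrightarrow> x \<preceq> y \<longleftrightarrow> x \<prec> y \<or> x = y"
  using le_refl by (auto simp: underS_def)

lemma small_bounded:
  assumes "B \<subseteq> Field \<kappa>" "|B| <o \<kappa>"
  obtains b where "b \<in> Field \<kappa>" "\<And>x. x \<in> B \<Longrightarrow> x \<preceq> b"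
proof -
  have "\<not> cofinal B \<kappa>"
    using assms regular not_ordLess_ordIso unfolding regularCard_def by blast
  then obtain b where "b \<in> Field \<kappa>" "\<And>x. x \<in> B \<Longrightarrow> b = x \<or> \<not> b \<preceq> x"
    unfolding cofinal_def by blast
  then show thesis
    using that assms(1) by (metis not_le le_refl less_imp_le subsetD)
qed

lemma small_image_bounded:
  assumes "|B| <o \<kappa>" "\<And>x. x \<in> B \<Longrightarrow> g x \<in> Field \<kappa>"
  shows "\<exists>b\<in>Field \<kappa>. \<forall>x\<in>B. g x \<preceq> b"
proof -
  have "g ` B \<subseteq> Field \<kappa>" using assms(2) by blast
  then obtain b where "b \<in> Field \<kappa>" "\<And>y. y \<in> g ` B \<Longrightarrow> y \<preceq> b"
    using small_bounded[OF _ ordLeq_ordLess_trans[OF card_of_image assms(1)]] by metis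
  then show ?thesis by auto
qed

lemma unbounded_card:
  assumes "B \<subseteq> Field \<kappa>" "\<And>b. b \<in> Field \<kappa> \<Longrightarrow> \<exists>x\<in>B. b \<prec> x"
  shows "|B| =o \<kappa>"
proof -
  have "cofinal B \<kappa>"
    using assms(2) unfolding cofinal_def underS_def by blast
  then show ?thesis
    using assms(1) regular unfolding regularCard_def by blast
qed

lemma Field_not_small: "\<not> |Field \<kappa>| <o \<kappa>"
  using card_of_Field_ordIso[OF Card_order] not_ordLess_ordIso by blast

lemma ex_greater:
  assumes "a \<in> Field \<kappa>"
  obtains b where "a \<prec> b"
proof -
  have "infinite (Field \<kappa>)"
    using natLeq_less Card_order infinite_iff_natLeq_ordLeq[of "Field \<kappa>"] ordLess_imp_ordLeq
      ordLeq_ordIso_trans[OF _ ordIso_symmetric[OF card_of_Field_ordIso[OF Card_order]]] by blast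
  from Card_order_infinite_not_under[OF Card_order this]
  obtain b where "b \<in> Field \<kappa>" "\<not> b \<preceq> a"
    using le_Field(1) unfolding under_def by blast
  then show thesis using that assms not_le by blast
qed

text \<open>\<open>wo_rel.suc\<close> is meaningful only where strict upper bounds exist; an
  infinite cardinal has no largest element, so they always do.\<close>

lemma suc:
  assumes "a \<in> Field \<kappa>"
  shows "a \<prec> wo_rel.suc \<kappa> {a}" and "\<And>b. a \<prec> b \<Longrightarrow> wo_rel.suc \<kappa> {a} \<preceq> b"
proof -
  obtain c where "a \<prec> c" using ex_greater[OF assms] .
  then have ne: "AboveS \<kappa> {a} \<noteq> {}"
    using less_Field(2)[of a c] by (auto simp: AboveS_def underS_def)
  then show "a \<prec> wo_rel.suc \<kappa> {a}"
    using wo_rel.suc_greater[OF wo_rel, of "{a}" a] assms by (auto simp: underS_def)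
  show "wo_rel.suc \<kappa> {a} \<preceq> b" if "a \<prec> b" for b
    using wo_rel.suc_least_AboveS[OF wo_rel, of b "{a}"] that less_Field[OF that]
    by (auto simp: AboveS_def underS_def)
qed

lemma less_suc_iff:
  assumes "a \<in> Field \<kappa>"
  shows "b \<prec> wo_rel.suc \<kappa> {a} \<longleftrightarrow> b \<preceq> a"
proof
  assume b: "b \<prec> wo_rel.suc \<kappa> {a}"
  have "\<not> a \<prec> b"
    using suc(2)[OF assms] le_less_trans[OF _ b] less_irrefl by blast
  then show "b \<preceq> a"
    using not_less[OF assms] less_Field(1)[OF b] by blast
next
  assume "b \<preceq> a"
  then show "b \<prec> wo_rel.suc \<kappa> {a}" using suc(1)[OF assms] by (rule le_less_trans)
qed

lemma limit_ordinalI: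
  assumes "\<beta> \<prec> \<alpha>" and "\<And>\<beta>. \<beta> \<prec> \<alpha> \<Longrightarrow> \<exists>\<gamma>. \<beta> \<prec> \<gamma> \<and> \<gamma> \<prec> \<alpha>"
  shows "limit_ordinal \<kappa> \<alpha>"
proof -
  have "wo_rel.suc \<kappa> {\<beta>} \<noteq> \<alpha>" if "\<beta> \<prec> \<alpha>" for \<beta>
  proof -
    from assms(2)[OF that] obtain \<gamma> where "\<beta> \<prec> \<gamma>" "\<gamma> \<prec> \<alpha>" by blast
    then have "wo_rel.suc \<kappa> {\<beta>} \<prec> \<alpha>"
      using suc(2) less_Field(1) le_less_trans by blast
    then show ?thesis using less_irrefl by blast
  qed
  then show ?thesis
    using assms(1) less_Field unfolding limit_ordinal_def by blast
qed

lemma limit_ordinal_between: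
  assumes "limit_ordinal \<kappa> \<alpha>" "\<beta> \<prec> \<alpha>"
  shows "\<beta> \<prec> wo_rel.suc \<kappa> {\<beta>}" "wo_rel.suc \<kappa> {\<beta>} \<prec> \<alpha>"
proof -
  have \<beta>: "\<beta> \<in> Field \<kappa>" using assms(2) less_Field by blast
  show "\<beta> \<prec> wo_rel.suc \<kappa> {\<beta>}" using suc(1)[OF \<beta>] .
  have "wo_rel.suc \<kappa> {\<beta>} \<preceq> \<alpha>" using suc(2)[OF \<beta> assms(2)] .
  moreover have "wo_rel.suc \<kappa> {\<beta>} \<noteq> \<alpha>"
    using assms unfolding limit_ordinal_def by blast
  ultimately show "wo_rel.suc \<kappa> {\<beta>} \<prec> \<alpha>" by (simp add: underS_def)
qed

section \<open>Elements of \<kappa> as order types\<close>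

lemma ord_Well_order: "Well_order (ord \<kappa> \<alpha>)"
  unfolding ord_def using Well_order by (rule Well_order_Restr)

lemma ord_ordLess: "\<alpha> \<in> Field \<kappa> \<Longrightarrow> ord \<kappa> \<alpha> <o \<kappa>"
  unfolding ord_def using underS_Restr_ordLess[OF Well_order] by auto

lemma ord_Restr:
  assumes "\<beta> \<prec> \<alpha>"
  shows "ord \<kappa> \<beta> = Restr (ord \<kappa> \<alpha>) (underS (ord \<kappa> \<alpha>) \<beta>)"
  using assms less_trans[of _ \<beta> \<alpha>] unfolding ord_def by (auto simp: underS_def)

lemma Field_ord: "Field (ord \<kappa> \<alpha>) = underS \<kappa> \<alpha>"
  unfolding ord_def using wo_rel.REFL[OF wo_rel] less_Field by (intro Refl_Field_Restr2) auto

lemma ord_strict_mono: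
  assumes "\<beta> \<prec> \<alpha>" shows "ord \<kappa> \<beta> <o ord \<kappa> \<alpha>"
  unfolding ord_Restr[OF assms]
  using underS_Restr_ordLess[OF ord_Well_order] Field_ord assms by fastforce

lemma less_linear:
  assumes "\<alpha> \<in> Field \<kappa>" "\<beta> \<in> Field \<kappa>"
  obtains "\<alpha> \<prec> \<beta>" | "\<alpha> = \<beta>" | "\<beta> \<prec> \<alpha>"
  using assms not_le le_iff_less_or_eq by blast

lemma ord_ordIso_iff:
  assumes "\<alpha> \<in> Field \<kappa>" "\<beta> \<in> Field \<kappa>"
  shows "ord \<kappa> \<alpha> =o ord \<kappa> \<beta> \<longleftrightarrow> \<alpha> = \<beta>"
proof
  assume iso: "ord \<kappa> \<alpha> =o ord \<kappa> \<beta>"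
  show "\<alpha> = \<beta>"
    using assms
  proof (cases rule: less_linear)
    case 1
    then show ?thesis using iso ord_strict_mono not_ordLess_ordIso by blast
  next
    case 3
    then show ?thesis
      using ordIso_symmetric[OF iso] ord_strict_mono not_ordLess_ordIso by blast
  qed
qed (simp add: ordIso_reflexive[OF ord_Well_order])

lemma ord_ordLess_iff:
  assumes "\<alpha> \<in> Field \<kappa>" "\<beta> \<in> Field \<kappa>"
  shows "ord \<kappa> \<alpha> <o ord \<kappa> \<beta> \<longleftrightarrow> \<alpha> \<prec> \<beta>"
proof
  assume *: "ord \<kappa> \<alpha> <o ord \<kappa> \<beta>"
  show "\<alpha> \<prec> \<beta>"
    using assms
  proof (cases rule: less_linear)
    case 2
    then show ?thesis using * ordLess_irreflexive by blast
  next
    case 3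
    then show ?thesis
      using ordLess_transitive[OF ord_strict_mono *] ordLess_irreflexive by blast
  qed
qed (rule ord_strict_mono)

end

section \<open>Trees with a rank function\<close>

text \<open>This is the height with values in \<open>Field \<kappa>\<close> instead of well-orders
  up to isomorphism. That predecessors are comparable and that their ranks fill an initial segment
  forces \<open>r t\<close> to be their order type. Both conditions can be checked directly for a
  subtree, without exhibiting isomorphisms.\<close>

definition rank_function :: "'a rel \<Rightarrow> 'b rel \<Rightarrow> ('b \<Rightarrow> 'a) \<Rightarrow> bool" where
  "rank_function \<kappa> T r \<longleftrightarrow>
     Partial_order T \<and> r ` Field T \<subseteq> Field \<kappa> \<and>
     (\<forall>s t u. (s, u) \<in> T \<and> (t, u) \<in> T \<longrightarrow> (s, t) \<in> T \<or> (t, s) \<in> T) \<and>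
     (\<forall>t\<in>Field T. r ` underS T t = underS \<kappa> (r t))"

text \<open>A height below \<kappa> is the order type of exactly one proper initial segment
  \<open>ord \<kappa> \<alpha>\<close>, and \<alpha> is the rank.\<close>

lemma (in regular_cardinal) rank_function_exists:
  assumes "tree T" and ht_less: "\<And>t. t \<in> Field T \<Longrightarrow> ht T t <o \<kappa>"
  obtains r where "rank_function \<kappa> T r"
proof -
  have po: "Partial_order T" and wo: "\<And>t. t \<in> Field T \<Longrightarrow> Well_order (ht T t)"
    using assms(1) unfolding tree_def ht_def by auto
  have refl: "(t, t) \<in> T" if "t \<in> Field T" for t
    using po that unfolding order_on_defs refl_on_def by blast
  have trans: "(s, u) \<in> T" if "(s, t) \<in> T" "(t, u) \<in> T" for s t u
    using po that unfolding order_on_defs by (blast dest: transD)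
  have antisym: "s = t" if "(s, t) \<in> T" "(t, s) \<in> T" for s t
    using po that unfolding order_on_defs by (blast dest: antisymD)
  have Field: "s \<in> Field T" if "s \<in> underS T t" for s t
    using that unfolding underS_def Field_def by blast
  have Field_ht: "Field (ht T t) = underS T t" for t
    unfolding ht_def using refl Field unfolding Field_def by blast
  have ht_pred: "ht T s = Restr (ht T t) (underS (ht T t) s)" if "s \<in> underS T t" for s t
  proof -
    have "underS (ht T t) s = underS T s"
      using that trans antisym unfolding ht_def underS_def by blast
    moreover have "underS T s \<subseteq> underS T t"
      using that trans antisym unfolding underS_def by blast
    ultimately show ?thesis unfolding ht_def by auto
  qed
  have "\<exists>\<alpha>\<in>Field \<kappa>. ht T t =o ord \<kappa> \<alpha>" if "t \<in> Field T" for t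
    using ordLess_iff_ordIso_Restr[OF Well_order wo[OF that]] ht_less[OF that]
    unfolding ord_def by blast
  then obtain r where r: "\<And>t. t \<in> Field T \<Longrightarrow> r t \<in> Field \<kappa>"
    "\<And>t. t \<in> Field T \<Longrightarrow> ht T t =o ord \<kappa> (r t)"
    by metis
  have "r ` underS T t = underS \<kappa> (r t)" if t: "t \<in> Field T" for t
  proof (intro equalityI subsetI)
    fix \<alpha> assume "\<alpha> \<in> r ` underS T t"
    then obtain s where s: "s \<in> underS T t" "\<alpha> = r s" by blast
    have "Field (ht T t) \<noteq> {}" using s(1) Field_ht by blast
    then have "ht T s <o ht T t"
      using underS_Restr_ordLess[OF wo[OF t]] ht_pred[OF s(1)] by simp
    then have "ord \<kappa> (r s) <o ord \<kappa> (r t)"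
      using r(2)[OF t] r(2)[OF Field[OF s(1)]] ordIso_ordLess_trans ordLess_ordIso_trans
        ordIso_symmetric by blast
    then show "\<alpha> \<in> underS \<kappa> (r t)"
      using ord_ordLess_iff r(1)[OF t] r(1)[OF Field[OF s(1)]] s(2) by blast
  next
    fix \<alpha> assume \<alpha>: "\<alpha> \<in> underS \<kappa> (r t)"
    \<comment> \<open>A smaller order type is that of a proper initial segment of the predecessors
      of \<open>t\<close>, and such a segment consists of the predecessors of some node below
      \<open>t\<close>.\<close>
    have "ord \<kappa> \<alpha> <o ht T t"
      using ordLess_ordIso_trans[OF ord_strict_mono[OF \<alpha>] ordIso_symmetric[OF r(2)[OF t]]] .
    then obtain s where s: "s \<in> underS T t" "ord \<kappa> \<alpha> =o ht T s"
      using ordLess_iff_ordIso_Restr[OF wo[OF t] ord_Well_order] ht_pred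
      unfolding Field_ht by metis
    have "ord \<kappa> \<alpha> =o ord \<kappa> (r s)"
      using ordIso_transitive[OF s(2) r(2)[OF Field[OF s(1)]]] .
    then have "\<alpha> = r s"
      using ord_ordIso_iff[OF _ r(1)[OF Field[OF s(1)]]] less_Field(1)[OF \<alpha>] by blast
    then show "\<alpha> \<in> r ` underS T t" using s(1) by blast
  qed
  moreover have "(s, t) \<in> T \<or> (t, s) \<in> T" if "(s, u) \<in> T" "(t, u) \<in> T" for s t u
  proof (cases "s = u \<or> t = u \<or> s = t")
    case True
    then show ?thesis using that refl[of s] unfolding Field_def by blast
  next
    case False
    then have st: "s \<in> underS T u" "t \<in> underS T u" using that by (auto simp: underS_def)
    have "u \<in> Field T" using that by (auto simp: Field_def)
    then have "Total (ht T u)" using wo unfolding order_on_defs by blast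
    then have "(s, t) \<in> ht T u \<or> (t, s) \<in> ht T u"
      using False st unfolding total_on_def Field_ht by blast
    then show ?thesis unfolding ht_def by blast
  qed
  ultimately have "rank_function \<kappa> T r"
    using po r(1) unfolding rank_function_def by blast
  then show thesis using that by blast
qed

locale ranked_tree = regular_cardinal \<kappa> for \<kappa> :: "'a rel" +
  fixes T :: "'b rel" and r :: "'b \<Rightarrow> 'a"
  assumes rank_function: "rank_function \<kappa> T r"
begin

lemma Partial_order: "Partial_order T"
  using rank_function unfolding rank_function_def by blast

lemma T_refl: "t \<in> Field T \<Longrightarrow> (t, t) \<in> T"
  using Partial_order unfolding order_on_defs refl_on_def by blast

lemma T_trans: "(s, t) \<in> T \<Longrightarrow> (t, u) \<in> T \<Longrightarrow> (s, u) \<in> T"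
  using Partial_order unfolding order_on_defs by (blast dest: transD)

lemma T_Field: "(s, t) \<in> T \<Longrightarrow> s \<in> Field T" "(s, t) \<in> T \<Longrightarrow> t \<in> Field T"
  by (auto simp: Field_def)

lemma rank_Field: "t \<in> Field T \<Longrightarrow> r t \<in> Field \<kappa>"
  using rank_function unfolding rank_function_def by blast

lemma comparable: "(s, u) \<in> T \<Longrightarrow> (t, u) \<in> T \<Longrightarrow> (s, t) \<in> T \<or> (t, s) \<in> T"
  using rank_function unfolding rank_function_def by blast

lemma rank_underS: "t \<in> Field T \<Longrightarrow> r ` underS T t = underS \<kappa> (r t)"
  using rank_function unfolding rank_function_def by blast

lemma rank_less: "s \<in> underS T t \<Longrightarrow> r s \<prec> r t"
  using rank_underS[of t] T_Field(2)[of s t] unfolding underS_def[of T] by blast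

lemma rank_le: "(s, t) \<in> T \<Longrightarrow> r s \<preceq> r t"
  using rank_less[of s t] less_imp_le le_refl[OF rank_Field] T_Field[of s t]
  unfolding underS_def[of T] by blast

lemma ex_predecessor:
  assumes "t \<in> Field T" "\<alpha> \<preceq> r t"
  obtains s where "(s, t) \<in> T" "r s = \<alpha>"
proof (cases "\<alpha> = r t")
  case True
  then show ?thesis using that T_refl[OF assms(1)] by blast
next
  case False
  then have "\<alpha> \<in> r ` underS T t"
    unfolding rank_underS[OF assms(1)] using assms(2) by (simp add: underS_def)
  then obtain s where "s \<in> underS T t" "r s = \<alpha>" by blast
  then show ?thesis using that by (auto simp: underS_def)
qed

lemma le_iff_rank_le:
  assumes "(s, t) \<in> T \<or> (t, s) \<in> T"
  shows "(s, t) \<in> T \<longleftrightarrow> r s \<preceq> r t"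
proof
  assume *: "r s \<preceq> r t"
  show "(s, t) \<in> T"
  proof (rule ccontr)
    assume "(s, t) \<notin> T"
    moreover from this have "s \<noteq> t" using assms by blast
    ultimately have "t \<in> underS T s" using assms by (simp add: underS_def)
    then show False using rank_less le_less_trans[OF *] less_irrefl by blast
  qed
qed (rule rank_le)

lemma eq_if_rank_eq:
  assumes "(s, t) \<in> T \<or> (t, s) \<in> T" "r s = r t"
  shows "s = t"
proof (rule ccontr)
  assume "s \<noteq> t"
  then have "s \<in> underS T t \<or> t \<in> underS T s" using assms(1) by (auto simp: underS_def)
  then show False using rank_less[of s t] rank_less[of t s] less_irrefl assms(2) by auto
qed

lemma ht_ordIso:
  assumes "t \<in> Field T"
  shows "ht T t =o ord \<kappa> (r t)"
  unfolding ht_def ord_def rank_underS[OF assms, symmetric]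
proof (rule Restr_ordIso_image[OF Well_order])
  have cmp: "(a, b) \<in> T \<or> (b, a) \<in> T" if "a \<in> underS T t" "b \<in> underS T t" for a b
    using that comparable unfolding underS_def by blast
  show "inj_on r (underS T t)"
    using cmp eq_if_rank_eq by (auto intro!: inj_onI)
  show "r ` underS T t \<subseteq> Field \<kappa>"
    using rank_underS[OF assms] less_Field by blast
  show "(a, b) \<in> T \<longleftrightarrow> r a \<preceq> r b" if "a \<in> underS T t" "b \<in> underS T t" for a b
    using le_iff_rank_le cmp that by blast
qed

lemma level_eq:
  assumes "\<alpha> \<in> Field \<kappa>"
  shows "level \<kappa> T \<alpha> = {t \<in> Field T. r t = \<alpha>}"
proof -
  have "ht T t =o ord \<kappa> \<alpha> \<longleftrightarrow> r t = \<alpha>" if "t \<in> Field T" for t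
  proof -
    have "ht T t =o ord \<kappa> \<alpha> \<longleftrightarrow> ord \<kappa> (r t) =o ord \<kappa> \<alpha>"
      using ordIso_transitive[OF ordIso_symmetric[OF ht_ordIso[OF that]]]
        ordIso_transitive[OF ht_ordIso[OF that]] by (rule iffI)
    then show ?thesis using ord_ordIso_iff[OF rank_Field[OF that] assms] by simp
  qed
  then show ?thesis unfolding level_def by blast
qed

lemma tree: "tree T"
  unfolding tree_def
  using Partial_order ht_ordIso unfolding ht_def ordIso_def by blast

lemma ht_ordLess: "t \<in> Field T \<Longrightarrow> ht T t <o \<kappa>"
  using ordIso_ordLess_trans[OF ht_ordIso ord_ordLess[OF rank_Field]] .

text \<open>The predecessor of \<open>u\<close> at the next height after \<open>t\<close> lies
  strictly above \<open>t\<close>; as nothing lies strictly between \<open>t\<close> and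
  \<open>u\<close>, it is \<open>u\<close> itself.\<close>

lemma rank_Succ:
  assumes "u \<in> Succ T t"
  shows "r u = wo_rel.suc \<kappa> {r t}"
proof -
  have tu: "t \<in> underS T u" and none: "aboveS T t \<inter> underS T u = {}"
    using assms unfolding Succ_def aboveS_def underS_def by auto
  then have u: "u \<in> Field T" and t: "t \<in> Field T" "(t, u) \<in> T"
    using T_Field unfolding underS_def by blast+
  have le: "wo_rel.suc \<kappa> {r t} \<preceq> r u"
    using suc(2)[OF rank_Field[OF t(1)] rank_less[OF tu]] .
  obtain s where s: "(s, u) \<in> T" "r s = wo_rel.suc \<kappa> {r t}"
    using ex_predecessor[OF u le] .
  have less: "r t \<prec> r s" using suc(1)[OF rank_Field[OF t(1)]] s(2) by simp
  have "(t, s) \<in> T"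
    using le_iff_rank_le[OF comparable[OF t(2) s(1)]] less_imp_le[OF less] by blast
  moreover have "s \<noteq> t" using less less_irrefl by force
  ultimately have "s \<in> aboveS T t" by (simp add: aboveS_def)
  then have "s = u" using none s(1) unfolding underS_def by blast
  then show ?thesis using s(2) by simp
qed

lemma SuccI:
  assumes "(t, u) \<in> T" "r u = wo_rel.suc \<kappa> {r t}"
  shows "u \<in> Succ T t"
proof -
  have t: "r t \<in> Field \<kappa>" using assms(1) T_Field rank_Field by blast
  have "u \<noteq> t" using assms(2) suc(1)[OF t] less_irrefl by force
  moreover have "False" if "s \<in> aboveS T t" "s \<in> underS T u" for s
  proof -
    have "r s \<prec> r u" using rank_less[OF that(2)] .
    then have "r s \<preceq> r t" using assms(2) less_suc_iff[OF t] by simp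
    moreover have "t \<in> underS T s" using that(1) unfolding aboveS_def underS_def by auto
    ultimately show False using rank_less le_less_trans less_irrefl by blast
  qed
  ultimately show ?thesis
    using assms(1) unfolding Succ_def aboveS_def by blast
qed

section \<open>Maximal paths and niceness in terms of ranks\<close>

lemma maximal_path_downward:
  assumes "maximal_path T M" "t \<in> M" "(s, t) \<in> T"
  shows "s \<in> M"
proof -
  have M: "(x, y) \<in> T \<or> (y, x) \<in> T" if "x \<in> M" "y \<in> M" for x y
    using assms(1) that unfolding maximal_path_def Chains_def by blast
  have s: "(s, s) \<in> T" using T_refl T_Field(1)[OF assms(3)] .
  have sx: "(s, x) \<in> T \<or> (x, s) \<in> T" if "x \<in> M" for x
    using M[OF assms(2) that] assms(3) T_trans comparable by blast
  have "insert s M \<in> Chains T"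
    using M s sx unfolding Chains_def by blast
  then show ?thesis
    using assms(1) unfolding maximal_path_def by blast
qed

text \<open>A maximal path is closed downwards, so a rank that it misses bounds all of its ranks. It
  then has fewer than \<kappa> nodes and cannot have order type \<kappa>.\<close>

lemma maximal_path_ordIso_iff:
  assumes "maximal_path T M"
  shows "Restr T M =o \<kappa> \<longleftrightarrow> r ` M = Field \<kappa>"
proof -
  have M: "(x, y) \<in> T \<or> (y, x) \<in> T" if "x \<in> M" "y \<in> M" for x y
    using assms that unfolding maximal_path_def Chains_def by blast
  then have sub: "r ` M \<subseteq> Field \<kappa>"
    using rank_Field T_Field by blast
  have iso: "Restr T M =o Restr \<kappa> (r ` M)"
  proof (rule Restr_ordIso_image[OF Well_order _ sub])
    show "inj_on r M" using M eq_if_rank_eq by (auto intro!: inj_onI)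
    show "(a, b) \<in> T \<longleftrightarrow> r a \<preceq> r b" if "a \<in> M" "b \<in> M" for a b
      using le_iff_rank_le M that by blast
  qed
  show ?thesis
  proof
    assume "r ` M = Field \<kappa>"
    then have "Restr \<kappa> (r ` M) = \<kappa>" unfolding Field_def by auto
    then show "Restr T M =o \<kappa>" using iso by simp
  next
    assume *: "Restr T M =o \<kappa>"
    show "r ` M = Field \<kappa>"
    proof (rule ccontr)
      assume "r ` M \<noteq> Field \<kappa>"
      then obtain \<gamma> where \<gamma>: "\<gamma> \<in> Field \<kappa>" "\<gamma> \<notin> r ` M" using sub by blast
      have "r ` M \<subseteq> underS \<kappa> \<gamma>"
      proof (rule ccontr)
        assume "\<not> ?thesis"
        then obtain t where t: "t \<in> M" "\<not> r t \<prec> \<gamma>" by blast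
        then have "t \<in> Field T" "\<gamma> \<preceq> r t" using M T_Field not_less \<gamma>(1) sub by blast+
        then obtain s where "(s, t) \<in> T" "r s = \<gamma>" using ex_predecessor by blast
        then show False using maximal_path_downward[OF assms t(1)] \<gamma>(2) by blast
      qed
      then have "|Field (Restr \<kappa> (r ` M))| \<le>o |underS \<kappa> \<gamma>|"
        by (intro card_of_mono1) (auto simp: Field_def)
      also have "|underS \<kappa> \<gamma>| <o \<kappa>" by (rule card_of_underS[OF Card_order \<gamma>(1)])
      finally have less: "|Field (Restr \<kappa> (r ` M))| <o \<kappa>" .
      have "\<kappa> =o Restr \<kappa> (r ` M)"
        using ordIso_transitive[OF ordIso_symmetric[OF *] iso] .
      then have "|Field \<kappa>| =o |Field (Restr \<kappa> (r ` M))|" by (rule card_of_cong)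
      then show False
        using ordIso_ordLess_trans[OF _ less] Field_not_small by blast
    qed
  qed
qed

text \<open>The rank function supplies the tree property and heights below \<kappa>, and any maximal
  path that meets every rank supplies unbounded heights. This form serves both to use the niceness
  of \<open>T\<close> and to verify that of the subtree.\<close>

lemma nice_tree_iff:
  "nice_tree \<kappa> T \<longleftrightarrow>
     (\<exists>!t. t \<in> Field T \<and> underS T t = {}) \<and>
     (\<forall>\<alpha>\<in>Field \<kappa>. |level \<kappa> T \<alpha>| <o \<kappa>) \<and>
     (\<forall>M. maximal_path T M \<longrightarrow> r ` M = Field \<kappa>) \<and>
     (\<forall>\<alpha>. limit_ordinal \<kappa> \<alpha> \<longrightarrow>
        (\<forall>s\<in>level \<kappa> T \<alpha>. \<forall>t\<in>level \<kappa> T \<alpha>. underS T s = underS T t \<longrightarrow> s = t)) \<and>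
     (\<forall>t\<in>Field T. \<exists>u\<in>Succ T t. \<exists>v\<in>Succ T t. (u, v) \<notin> T \<and> (v, u) \<notin> T)"
proof -
  have "\<forall>\<alpha>\<in>Field \<kappa>. \<exists>t\<in>Field T. ord \<kappa> \<alpha> \<le>o ht T t"
    if paths: "\<forall>M. maximal_path T M \<longrightarrow> r ` M = Field \<kappa>"
  proof
    fix \<alpha> assume "\<alpha> \<in> Field \<kappa>"
    have "{} \<in> Chains T" by (simp add: Chains_def)
    then obtain M where M: "maximal_path T M" using Chains_maximal_path by blast
    then have "\<alpha> \<in> r ` M" using paths \<open>\<alpha> \<in> Field \<kappa>\<close> by simp
    then obtain t where t: "t \<in> M" "r t = \<alpha>" by blast
    then have "t \<in> Field T" using M T_Field unfolding maximal_path_def Chains_def by blast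
    moreover from this have "ord \<kappa> \<alpha> \<le>o ht T t"
      using ordIso_imp_ordLeq[OF ordIso_symmetric[OF ht_ordIso[of t]]] t(2) by simp
    ultimately show "\<exists>t\<in>Field T. ord \<kappa> \<alpha> \<le>o ht T t" by blast
  qed
  moreover have "(\<forall>M. maximal_path T M \<longrightarrow> Restr T M =o \<kappa>) \<longleftrightarrow>
      (\<forall>M. maximal_path T M \<longrightarrow> r ` M = Field \<kappa>)"
    using maximal_path_ordIso_iff by (intro all_cong1 imp_cong refl)
  moreover have "\<forall>t\<in>Field T. ht T t <o \<kappa>"
    using ht_ordLess by (rule ballI)
  ultimately show ?thesis
    unfolding nice_tree_def using tree by argo
qed

end

locale nice_ranked_tree = ranked_tree +
  assumes nice: "nice_tree \<kappa> T"
begin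

lemma card_level:
  assumes "\<alpha> \<in> Field \<kappa>"
  shows "|{t \<in> Field T. r t = \<alpha>}| <o \<kappa>"
  using nice assms unfolding nice_tree_iff level_eq[OF assms, symmetric] by blast

text \<open>A maximal path through the chain meets rank \<beta>, and its node there lies above the
  chain. This carries the limit steps, both of the recursion along the colours and of the
  subtree.\<close>

lemma chain_upper_bound:
  assumes "C \<in> Chains T" "\<beta> \<in> Field \<kappa>" "\<And>t. t \<in> C \<Longrightarrow> r t \<preceq> \<beta>"
  obtains u where "u \<in> Field T" "r u = \<beta>" "\<And>t. t \<in> C \<Longrightarrow> (t, u) \<in> T"
proof -
  obtain M where M: "maximal_path T M" "C \<subseteq> M"
    using Chains_maximal_path[OF assms(1)] .
  then have "r ` M = Field \<kappa>" using nice unfolding nice_tree_iff by blast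
  then have "\<beta> \<in> r ` M" using assms(2) by simp
  then obtain u where u: "u \<in> M" "r u = \<beta>" by blast
  have cmp: "(x, y) \<in> T \<or> (y, x) \<in> T" if "x \<in> M" "y \<in> M" for x y
    using M(1) that unfolding maximal_path_def Chains_def by blast
  have "(t, u) \<in> T" if "t \<in> C" for t
    using le_iff_rank_le[OF cmp[of t u]] M(2) u assms(3) that by blast
  moreover have "u \<in> Field T" using cmp[OF u(1) u(1)] T_Field by blast
  ultimately show thesis using that u(2) by blast
qed

lemma extension:
  assumes "t \<in> Field T" "r t \<preceq> \<beta>"
  obtains u where "(t, u) \<in> T" "r u = \<beta>"
proof -
  have "{t} \<in> Chains T" using T_refl[OF assms(1)] by (simp add: Chains_def)
  then show thesis
    using chain_upper_bound[of "{t}" \<beta>] assms(2) le_Field(2)[OF assms(2)] that by blast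
qed

lemma limit_level_unique:
  assumes "limit_ordinal \<kappa> (r s)" "s \<in> Field T" "t \<in> Field T" "r s = r t"
    and "underS T s = underS T t"
  shows "s = t"
proof -
  have "s \<in> level \<kappa> T (r s)" "t \<in> level \<kappa> T (r s)"
    unfolding level_eq[OF rank_Field[OF assms(2)]] using assms by simp_all
  then show ?thesis
    using nice assms(1,5) unfolding nice_tree_iff by blast
qed

lemma ex_incomparable_Succ:
  assumes "t \<in> Field T"
  obtains u v where "u \<in> Succ T t" "v \<in> Succ T t" "(u, v) \<notin> T" "(v, u) \<notin> T"
proof -
  have "\<exists>u\<in>Succ T t. \<exists>v\<in>Succ T t. (u, v) \<notin> T \<and> (v, u) \<notin> T"
    using nice assms unfolding nice_tree_def by blast
  then show thesis using that by blast
qed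

end

section \<open>A dense colour modulo a saturated ideal\<close>

locale saturated_tree = nice_ranked_tree \<kappa> T r for \<kappa> :: "'a rel" and T :: "'b rel" and r +
  fixes I :: "'a set set" and f :: "'b \<Rightarrow> 'a"
  assumes ideal: "ideal_on (Field \<kappa>) I"
    and complete: "complete_ideal \<kappa> I"
    and saturated: "saturated_ideal \<kappa> I"
begin

text \<open>The set L(s, c) of the overview.\<close>

definition hits :: "'b \<Rightarrow> 'a \<Rightarrow> 'a set" where
  "hits s c = {\<alpha>. \<exists>v. (s, v) \<in> T \<and> r v = \<alpha> \<and> f v = c}"

lemma null_mono: "X \<in> I \<Longrightarrow> Y \<subseteq> X \<Longrightarrow> Y \<in> I"
  using ideal unfolding ideal_on_def by blast

lemma null_Un: "X \<in> I \<Longrightarrow> Y \<in> I \<Longrightarrow> X \<union> Y \<in> I"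
  using ideal unfolding ideal_on_def by blast

lemma null_empty: "{} \<in> I"
  using ideal unfolding ideal_on_def by blast

lemma Field_not_null: "Field \<kappa> \<notin> I"
  using ideal unfolding ideal_on_def by blast

lemma null_UN:
  assumes "|B| <o \<kappa>" "\<And>b. b \<in> B \<Longrightarrow> N b \<in> I"
  shows "(\<Union>b\<in>B. N b) \<in> I"
proof -
  have "|N ` B| <o \<kappa>" using ordLeq_ordLess_trans[OF card_of_image assms(1)] .
  moreover have "N ` B \<subseteq> I" using assms(2) by blast
  ultimately show ?thesis using complete unfolding complete_ideal_def by blast
qed

lemma null_underS:
  assumes "\<beta> \<in> Field \<kappa>"
  shows "underS \<kappa> \<beta> \<in> I"
proof -
  have "(\<Union>\<alpha>\<in>underS \<kappa> \<beta>. {\<alpha>}) \<in> I"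
  proof (rule null_UN[OF card_of_underS[OF Card_order assms]])
    show "{\<alpha>} \<in> I" if "\<alpha> \<prec> \<beta>" for \<alpha>
      using ideal less_Field(1)[OF that] unfolding ideal_on_def by blast
  qed
  then show ?thesis by simp
qed

section \<open>Maximal antichains and maps that avoid one colour\<close>

lemma ex_maximal_antichain:
  assumes "P \<subseteq> Pow (Field \<kappa>) - I"
  obtains W where "W \<subseteq> P" "|W| <o \<kappa>"
    "\<forall>X\<in>P. (\<forall>Y\<in>W. X \<inter> Y \<in> I) \<longrightarrow> X \<in> W"
proof -
  define A where "A = {W. W \<subseteq> P \<and> (\<forall>X\<in>W. \<forall>Y\<in>W. X \<noteq> Y \<longrightarrow> X \<inter> Y \<in> I)}"
  have "\<exists>W\<in>A. \<forall>V\<in>A. W \<subseteq> V \<longrightarrow> V = W"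
  proof (rule subset_Zorn')
    fix \<C> assume ch: "subset.chain A \<C>"
    then have sub: "\<C> \<subseteq> A" unfolding subset.chain_def by (rule conjunct1)
    have "X \<inter> Y \<in> I" if V: "V \<in> \<C>" and W: "W \<in> \<C>" and XY: "X \<in> V" "Y \<in> W" "X \<noteq> Y"
      for V W X Y
    proof -
      have "V \<subseteq> W \<or> W \<subseteq> V"
        using ch V W unfolding subset.chain_def by auto
      moreover have "V \<in> A" "W \<in> A" using sub V W by auto
      ultimately show ?thesis using XY unfolding A_def by blast
    qed
    moreover have "\<Union>\<C> \<subseteq> P" using sub unfolding A_def by blast
    ultimately show "\<Union>\<C> \<in> A" unfolding A_def by blast
  qed
  then obtain W where W: "W \<in> A" and max: "\<And>V. V \<in> A \<Longrightarrow> W \<subseteq> V \<Longrightarrow> V = W" by auto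
  show thesis
  proof (rule that)
    show "W \<subseteq> P" using W by (simp add: A_def)
    then show "|W| <o \<kappa>"
      using saturated W assms unfolding saturated_ideal_def A_def by simp
    show "\<forall>X\<in>P. (\<forall>Y\<in>W. X \<inter> Y \<in> I) \<longrightarrow> X \<in> W"
    proof (intro ballI impI)
      fix X assume X: "X \<in> P" "\<forall>Y\<in>W. X \<inter> Y \<in> I"
      have "insert X W \<in> A" using W X unfolding A_def by (auto simp: Int_commute)
      then have "insert X W = W" by (rule max) blast
      then show "X \<in> W" by (rule subst) (rule insertI1)
    qed
  qed
qed

text \<open>The members of \<open>P\<close> are the positive sets for which one node above
  \<open>t\<close> works throughout. If a maximal antichain in \<open>P\<close> left a positive
  remainder, the hypothesis would cut a further member of \<open>P\<close> out of it, disjoint from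
  all the others.\<close>

lemma ex_bounded_avoiding:
  assumes t: "t \<in> Field T"
    and avoid: "\<And>X. X \<subseteq> Field \<kappa> \<Longrightarrow> X \<notin> I \<Longrightarrow> \<exists>s. (t, s) \<in> T \<and> X - hits s c \<notin> I"
  shows "\<exists>h. (\<exists>\<beta>\<in>Field \<kappa>. \<forall>\<alpha>. (t, h \<alpha>) \<in> T \<and> r (h \<alpha>) \<preceq> \<beta>) \<and>
    {\<alpha> \<in> Field \<kappa>. \<alpha> \<in> hits (h \<alpha>) c} \<in> I"
proof -
  define P where "P = {Y. Y \<subseteq> Field \<kappa> \<and> Y \<notin> I \<and> (\<exists>s. (t, s) \<in> T \<and> Y \<inter> hits s c = {})}"
  have "P \<subseteq> Pow (Field \<kappa>) - I" unfolding P_def by blast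
  then obtain W where W: "W \<subseteq> P" and card: "|W| <o \<kappa>"
    and max: "\<forall>X\<in>P. (\<forall>Y\<in>W. X \<inter> Y \<in> I) \<longrightarrow> X \<in> W"
    using ex_maximal_antichain by metis
  have null: "Field \<kappa> - \<Union>W \<in> I"
  proof (rule ccontr)
    assume "Field \<kappa> - \<Union>W \<notin> I"
    then obtain s where s: "(t, s) \<in> T" "Field \<kappa> - \<Union>W - hits s c \<notin> I"
      using avoid by blast
    let ?Z = "Field \<kappa> - \<Union>W - hits s c"
    have "?Z \<in> P" using s unfolding P_def by blast
    moreover have "\<forall>Y\<in>W. ?Z \<inter> Y \<in> I"
    proof
      fix Y assume "Y \<in> W"
      then have "?Z \<inter> Y = {}" by blast
      then show "?Z \<inter> Y \<in> I" using null_empty by simp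
    qed
    ultimately have "?Z \<in> W" using max by simp
    then have "?Z \<subseteq> \<Union>W" by (rule Union_upper)
    then have "?Z = {}" by blast
    then show False using s(2) null_empty by metis
  qed
  have "\<exists>s. (t, s) \<in> T \<and> Y \<inter> hits s c = {}" if "Y \<in> W" for Y
    using W that unfolding P_def by blast
  then obtain s where s: "\<And>Y. Y \<in> W \<Longrightarrow> (t, s Y) \<in> T" "\<And>Y. Y \<in> W \<Longrightarrow> Y \<inter> hits (s Y) c = {}"
    by metis
  \<comment> \<open>Pieces may overlap, but any piece that contains \<alpha> will do, since each is
    disjoint from the hits of its own node. The default \<open>t\<close> is taken only outside the
    pieces, hence on a null set as far as \<open>Field \<kappa>\<close> is concerned.\<close>
  define h where "h \<alpha> = (if \<alpha> \<in> \<Union>W then s (SOME Y. Y \<in> W \<and> \<alpha> \<in> Y) else t)" for \<alpha>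
  have h: "\<exists>Y\<in>W. \<alpha> \<in> Y \<and> h \<alpha> = s Y" if "\<alpha> \<in> \<Union>W" for \<alpha>
  proof -
    have "\<exists>Y. Y \<in> W \<and> \<alpha> \<in> Y" using that by blast
    from someI_ex[OF this] show ?thesis using that unfolding h_def by auto
  qed
  have "r (s Y) \<in> Field \<kappa>" if "Y \<in> W" for Y
    using rank_Field[OF T_Field(2)[OF s(1)[OF that]]] .
  then have "\<exists>b\<in>Field \<kappa>. \<forall>Y\<in>W. r (s Y) \<preceq> b"
    by (rule small_image_bounded[OF card])
  then obtain b where b: "b \<in> Field \<kappa>" "\<And>Y. Y \<in> W \<Longrightarrow> r (s Y) \<preceq> b" by auto
  \<comment> \<open>The maximum with \<open>r t\<close> is taken because of the default value
    \<open>t\<close>.\<close>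
  define \<beta> where "\<beta> = (if r t \<preceq> b then b else r t)"
  have \<beta>: "\<beta> \<in> Field \<kappa>" "r t \<preceq> \<beta>" "b \<preceq> \<beta>"
    unfolding \<beta>_def using b(1) rank_Field[OF t] le_refl not_le less_imp_le by auto
  have "(t, h \<alpha>) \<in> T \<and> r (h \<alpha>) \<preceq> \<beta>" for \<alpha>
  proof (cases "\<alpha> \<in> \<Union>W")
    case True
    then show ?thesis using h[OF True] s(1) le_trans[OF b(2) \<beta>(3)] by auto
  next
    case False
    then show ?thesis using T_refl[OF t] \<beta>(2) by (simp add: h_def)
  qed
  moreover have "\<alpha> \<notin> hits (h \<alpha>) c" if "\<alpha> \<in> \<Union>W" for \<alpha>
    using h[OF that] s(2) by force
  then have "{\<alpha> \<in> Field \<kappa>. \<alpha> \<in> hits (h \<alpha>) c} \<in> I"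
    by (intro null_mono[OF null]) auto
  ultimately show ?thesis using \<beta>(1) by (intro exI[of _ h]) auto
qed

text \<open>The starting node may now vary with \<alpha>. As it stays on a single level, fewer than
  \<kappa> maps \<open>H t\<close> are involved: regularity bounds them together and completeness
  unites their exceptional sets.\<close>

lemma ex_bounded_avoiding_above:
  assumes avoid: "\<And>X t. X \<subseteq> Field \<kappa> \<Longrightarrow> X \<notin> I \<Longrightarrow> t \<in> Field T \<Longrightarrow>
      \<exists>s. (t, s) \<in> T \<and> X - hits s c \<notin> I"
    and \<beta>: "\<beta> \<in> Field \<kappa>" and p: "\<And>\<alpha>. p \<alpha> \<in> Field T" "\<And>\<alpha>. r (p \<alpha>) = \<beta>"
  shows "\<exists>g. (\<exists>\<gamma>\<in>Field \<kappa>. \<forall>\<alpha>. (p \<alpha>, g \<alpha>) \<in> T \<and> r (g \<alpha>) \<preceq> \<gamma>) \<and>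
    {\<alpha> \<in> Field \<kappa>. \<alpha> \<in> hits (g \<alpha>) c} \<in> I"
proof -
  define L where "L = {t \<in> Field T. r t = \<beta>}"
  have "\<exists>h. (\<exists>b\<in>Field \<kappa>. \<forall>\<alpha>. (t, h \<alpha>) \<in> T \<and> r (h \<alpha>) \<preceq> b) \<and>
      {\<alpha> \<in> Field \<kappa>. \<alpha> \<in> hits (h \<alpha>) c} \<in> I" if "t \<in> L" for t
  proof -
    have t: "t \<in> Field T" using that unfolding L_def by blast
    show ?thesis by (rule ex_bounded_avoiding[OF t avoid[OF _ _ t]])
  qed
  then obtain H where "\<forall>t\<in>L. (\<exists>b\<in>Field \<kappa>. \<forall>\<alpha>. (t, H t \<alpha>) \<in> T \<and> r (H t \<alpha>) \<preceq> b) \<and>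
      {\<alpha> \<in> Field \<kappa>. \<alpha> \<in> hits (H t \<alpha>) c} \<in> I"
    using bchoice[of L "\<lambda>t h. (\<exists>b\<in>Field \<kappa>. \<forall>\<alpha>. (t, h \<alpha>) \<in> T \<and> r (h \<alpha>) \<preceq> b) \<and>
      {\<alpha> \<in> Field \<kappa>. \<alpha> \<in> hits (h \<alpha>) c} \<in> I"] by auto
  then have bd: "\<forall>t\<in>L. \<exists>b\<in>Field \<kappa>. \<forall>\<alpha>. (t, H t \<alpha>) \<in> T \<and> r (H t \<alpha>) \<preceq> b"
    and null: "\<And>t. t \<in> L \<Longrightarrow> {\<alpha> \<in> Field \<kappa>. \<alpha> \<in> hits (H t \<alpha>) c} \<in> I"
    by simp_all
  from bd obtain b where b: "\<And>t. t \<in> L \<Longrightarrow> b t \<in> Field \<kappa>"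
    "\<And>t \<alpha>. t \<in> L \<Longrightarrow> (t, H t \<alpha>) \<in> T" "\<And>t \<alpha>. t \<in> L \<Longrightarrow> r (H t \<alpha>) \<preceq> b t"
    by metis
  have card: "|L| <o \<kappa>" unfolding L_def by (rule card_level[OF \<beta>])
  have "\<exists>\<gamma>\<in>Field \<kappa>. \<forall>t\<in>L. b t \<preceq> \<gamma>"
    by (rule small_image_bounded[OF card b(1)])
  then obtain \<gamma> where \<gamma>: "\<gamma> \<in> Field \<kappa>" "\<And>t. t \<in> L \<Longrightarrow> b t \<preceq> \<gamma>" by auto
  define g where "g \<alpha> = H (p \<alpha>) \<alpha>" for \<alpha>
  have pL: "p \<alpha> \<in> L" for \<alpha> using p unfolding L_def by blast
  have "(p \<alpha>, g \<alpha>) \<in> T \<and> r (g \<alpha>) \<preceq> \<gamma>" for \<alpha>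
    using b(2)[OF pL] le_trans[OF b(3)[OF pL] \<gamma>(2)[OF pL]] unfolding g_def by simp
  moreover have "(\<Union>t\<in>L. {\<alpha> \<in> Field \<kappa>. \<alpha> \<in> hits (H t \<alpha>) c}) \<in> I"
    by (rule null_UN[OF card null])
  then have "{\<alpha> \<in> Field \<kappa>. \<alpha> \<in> hits (g \<alpha>) c} \<in> I"
    by (rule null_mono) (use pL in \<open>auto simp: g_def\<close>)
  ultimately show ?thesis using \<gamma>(1) by (intro exI[of _ g]) auto
qed

lemma ex_dense_colour:
  assumes \<delta>: "\<delta> \<in> Field \<kappa>" and f: "\<And>t. t \<in> Field T \<Longrightarrow> f t \<prec> \<delta>"
  shows "\<exists>X t c. X \<subseteq> Field \<kappa> \<and> X \<notin> I \<and> t \<in> Field T \<and> (\<forall>s. (t, s) \<in> T \<longrightarrow> X - hits s c \<in> I)"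
proof (rule ccontr)
  assume not_dense: "\<not> ?thesis"
  then have avoid: "\<exists>s. (t, s) \<in> T \<and> X - hits s c \<notin> I"
    if "X \<subseteq> Field \<kappa>" "X \<notin> I" "t \<in> Field T" for X t c
    using that not_dense by auto
  \<comment> \<open>For each fixed \<alpha> the nodes \<open>G c \<alpha>\<close> increase with
    \<open>c\<close>. The recursion runs over the whole type, hence the guard
    \<open>c \<in> Field \<kappa>\<close>; \<open>G\<close> enters only through its values below
    \<open>c\<close>, as recursion requires.\<close>
  define Q where "Q G c g \<longleftrightarrow> (c \<in> Field \<kappa> \<longrightarrow>
      (\<exists>\<beta>\<in>Field \<kappa>. \<forall>\<alpha>. g \<alpha> \<in> Field T \<and> r (g \<alpha>) \<preceq> \<beta>) \<and>
      (\<forall>c'. (c', c) \<in> \<kappa> - Id \<longrightarrow> (\<forall>\<alpha>. (G c' \<alpha>, g \<alpha>) \<in> T)) \<and>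
      {\<alpha> \<in> Field \<kappa>. \<alpha> \<in> hits (g \<alpha>) c} \<in> I)"
    for G :: "'a \<Rightarrow> 'a \<Rightarrow> 'b" and c g
  have lt: "(c', c) \<in> \<kappa> - Id \<longleftrightarrow> c' \<prec> c" for c' c by (auto simp: underS_def)
  have "\<exists>G. \<forall>c. Q G c (G c)"
  proof (rule dependent_wf_choice)
    show "wf (\<kappa> - Id)" by (rule wo_rel.WF[OF wo_rel])
  next
    fix G G' :: "'a \<Rightarrow> 'a \<Rightarrow> 'b" and c g
    assume "\<And>z. (z, c) \<in> \<kappa> - Id \<Longrightarrow> G z = G' z"
    then have "(\<forall>c'. (c', c) \<in> \<kappa> - Id \<longrightarrow> (\<forall>\<alpha>. (G c' \<alpha>, g \<alpha>) \<in> T)) \<longleftrightarrow>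
      (\<forall>c'. (c', c) \<in> \<kappa> - Id \<longrightarrow> (\<forall>\<alpha>. (G' c' \<alpha>, g \<alpha>) \<in> T))" by simp
    then show "Q G c g = Q G' c g" unfolding Q_def by argo
  next
    fix c and G :: "'a \<Rightarrow> 'a \<Rightarrow> 'b"
    assume "\<And>y. (y, c) \<in> \<kappa> - Id \<Longrightarrow> Q G y (G y)"
    then have IH: "Q G y (G y)" if "y \<prec> c" for y using that lt by blast
    show "\<exists>g. Q G c g"
    proof (cases "c \<in> Field \<kappa>")
      case False
      then show ?thesis unfolding Q_def by blast
    next
      case True
      have bd: "\<exists>\<beta>\<in>Field \<kappa>. \<forall>\<alpha>. G y \<alpha> \<in> Field T \<and> r (G y \<alpha>) \<preceq> \<beta>" if "y \<prec> c" for y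
        using IH[OF that] less_Field(1)[OF that] unfolding Q_def by blast
      then obtain b where b: "\<And>y. y \<prec> c \<Longrightarrow> b y \<in> Field \<kappa>"
        "\<And>y \<alpha>. y \<prec> c \<Longrightarrow> G y \<alpha> \<in> Field T" "\<And>y \<alpha>. y \<prec> c \<Longrightarrow> r (G y \<alpha>) \<preceq> b y"
        by metis
      \<comment> \<open>There are fewer than \<kappa> earlier stages, so one \<beta> bounds them for
        all \<alpha> at once, and the nodes \<open>p \<alpha>\<close> above them can be put on the
        same level. At the first stage the chain is empty and the same argument applies.\<close>
      have "\<exists>\<beta>\<in>Field \<kappa>. \<forall>y\<in>underS \<kappa> c. b y \<preceq> \<beta>"
        by (rule small_image_bounded[OF card_of_underS[OF Card_order True] b(1)])
      then obtain \<beta> where \<beta>: "\<beta> \<in> Field \<kappa>" "\<And>y. y \<prec> c \<Longrightarrow> b y \<preceq> \<beta>" by auto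
      have G_mono: "(G y \<alpha>, G z \<alpha>) \<in> T" if "y \<prec> z" "z \<prec> c" for y z \<alpha>
        using IH[OF that(2)] lt that less_Field(1)[OF that(2)] unfolding Q_def by blast
      have "\<exists>u. u \<in> Field T \<and> r u = \<beta> \<and> (\<forall>y. y \<prec> c \<longrightarrow> (G y \<alpha>, u) \<in> T)" for \<alpha>
      proof -
        let ?C = "(\<lambda>y. G y \<alpha>) ` underS \<kappa> c"
        have "(G y \<alpha>, G z \<alpha>) \<in> T \<or> (G z \<alpha>, G y \<alpha>) \<in> T" if "y \<prec> c" "z \<prec> c" for y z
          using less_Field(1)[OF that(1)] less_Field(1)[OF that(2)]
        proof (cases rule: less_linear)
          case 1
          then show ?thesis using G_mono that by blast
        next
          case 2
          then show ?thesis using T_refl b(2) that by simp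
        next
          case 3
          then show ?thesis using G_mono that by blast
        qed
        then have "?C \<in> Chains T" unfolding Chains_def by blast
        moreover have "r t \<preceq> \<beta>" if "t \<in> ?C" for t
          using that le_trans[OF b(3) \<beta>(2)] by blast
        ultimately obtain u where "u \<in> Field T" "r u = \<beta>" "\<forall>t\<in>?C. (t, u) \<in> T"
          using chain_upper_bound[OF _ \<beta>(1), of ?C] by metis
        then show ?thesis by auto
      qed
      then obtain p where p: "\<And>\<alpha>. p \<alpha> \<in> Field T" "\<And>\<alpha>. r (p \<alpha>) = \<beta>"
        "\<And>\<alpha> y. y \<prec> c \<Longrightarrow> (G y \<alpha>, p \<alpha>) \<in> T"
        by metis
      have "\<exists>g. (\<exists>\<gamma>\<in>Field \<kappa>. \<forall>\<alpha>. (p \<alpha>, g \<alpha>) \<in> T \<and> r (g \<alpha>) \<preceq> \<gamma>) \<and>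
          {\<alpha> \<in> Field \<kappa>. \<alpha> \<in> hits (g \<alpha>) c} \<in> I"
        by (rule ex_bounded_avoiding_above[OF avoid \<beta>(1) p(1,2)])
      then obtain g \<gamma> where g: "\<gamma> \<in> Field \<kappa>" "\<And>\<alpha>. (p \<alpha>, g \<alpha>) \<in> T" "\<And>\<alpha>. r (g \<alpha>) \<preceq> \<gamma>"
        "{\<alpha> \<in> Field \<kappa>. \<alpha> \<in> hits (g \<alpha>) c} \<in> I"
        by auto
      have "\<exists>\<beta>\<in>Field \<kappa>. \<forall>\<alpha>. g \<alpha> \<in> Field T \<and> r (g \<alpha>) \<preceq> \<beta>"
        using g(1,3) T_Field(2)[OF g(2)] by auto
      moreover have "\<forall>c'. c' \<prec> c \<longrightarrow> (\<forall>\<alpha>. (G c' \<alpha>, g \<alpha>) \<in> T)"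
        using T_trans[OF p(3) g(2)] by simp
      ultimately have "Q G c g"
        unfolding Q_def lt using g(4) by simp
      then show ?thesis by (rule exI[of "Q G c"])
    qed
  qed
  then obtain G where G: "\<And>c. Q G c (G c)" by blast
  \<comment> \<open>Stage \<delta> comes just after all the colours:
    \<open>G \<delta> \<alpha>\<close> lies above \<open>G c \<alpha>\<close> for every colour
    \<open>c\<close>, so whatever extends it extends all of these.\<close>
  obtain \<beta> where \<beta>: "\<beta> \<in> Field \<kappa>" "\<And>\<alpha>. G \<delta> \<alpha> \<in> Field T" "\<And>\<alpha>. r (G \<delta> \<alpha>) \<preceq> \<beta>"
    using G[of \<delta>] \<delta> unfolding Q_def by blast
  let ?N = "\<Union>c\<in>underS \<kappa> \<delta>. {\<alpha> \<in> Field \<kappa>. \<alpha> \<in> hits (G c \<alpha>) c}"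
  have "?N \<in> I"
  proof (rule null_UN[OF card_of_underS[OF Card_order \<delta>]])
    show "{\<alpha> \<in> Field \<kappa>. \<alpha> \<in> hits (G c \<alpha>) c} \<in> I" if "c \<prec> \<delta>" for c
      using G[of c] less_Field(1)[OF that] unfolding Q_def by blast
  qed
  moreover have "Field \<kappa> \<subseteq> underS \<kappa> \<beta> \<union> ?N"
  proof
    fix \<alpha> assume \<alpha>: "\<alpha> \<in> Field \<kappa>"
    show "\<alpha> \<in> underS \<kappa> \<beta> \<union> ?N"
    proof (cases "\<alpha> \<prec> \<beta>")
      case False
      then have "r (G \<delta> \<alpha>) \<preceq> \<alpha>" using not_less[OF \<alpha> \<beta>(1)] le_trans[OF \<beta>(3)] by blast
      then obtain u where u: "(G \<delta> \<alpha>, u) \<in> T" "r u = \<alpha>"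
        using extension[OF \<beta>(2)] by blast
      have c: "f u \<prec> \<delta>" using f T_Field(2)[OF u(1)] .
      have "(G (f u) \<alpha>, G \<delta> \<alpha>) \<in> T"
        using G[of \<delta>] \<delta> c lt unfolding Q_def by blast
      then have "\<alpha> \<in> hits (G (f u) \<alpha>) (f u)"
        using T_trans u unfolding hits_def by blast
      then show ?thesis using \<alpha> c by blast
    qed blast
  qed
  ultimately show False
    using null_mono[OF null_Un[OF null_underS[OF \<beta>(1)]]] Field_not_null by blast
qed

end

section \<open>The strong subtree\<close>

text \<open>A cardinal is the least well-order of its size, so \<open>A\<close> has at least order
  type \<kappa>. If it had more, some proper initial segment of \<open>A\<close> would have order
  type \<kappa>, but such a segment has fewer than \<kappa> elements.\<close>

lemma (in regular_cardinal) Restr_ordIso_if_card: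
  assumes A: "A \<subseteq> Field \<kappa>" "|A| =o \<kappa>"
  shows "Restr \<kappa> A =o \<kappa>"
proof -
  have woA: "Well_order (Restr \<kappa> A)" using Well_order by (rule Well_order_Restr)
  have FA: "Field (Restr \<kappa> A) = A"
    using A(1) wo_rel.REFL[OF wo_rel] by (rule Refl_Field_Restr2[rotated])
  have "well_order_on A (Restr \<kappa> A)" using woA FA by simp
  then have "|A| \<le>o Restr \<kappa> A" by (rule card_of_least)
  then have le: "\<kappa> \<le>o Restr \<kappa> A"
    by (rule ordIso_ordLeq_trans[OF ordIso_symmetric[OF A(2)]])
  have "\<not> \<kappa> <o Restr \<kappa> A"
  proof
    assume "\<kappa> <o Restr \<kappa> A"
    then obtain a where a: "a \<in> A" "\<kappa> =o Restr (Restr \<kappa> A) (underS (Restr \<kappa> A) a)"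
      using ordLess_iff_ordIso_Restr[OF woA Well_order] unfolding FA by blast
    have "Field (Restr (Restr \<kappa> A) (underS (Restr \<kappa> A) a)) \<subseteq> underS \<kappa> a"
      by (auto simp: Field_def underS_def)
    then have "|Field (Restr (Restr \<kappa> A) (underS (Restr \<kappa> A) a))| <o \<kappa>"
      using ordLeq_ordLess_trans[OF card_of_mono1 card_of_underS[OF Card_order]] a(1) A(1) by blast
    then show False
      using ordIso_ordLess_trans[OF card_of_cong[OF a(2)]] Field_not_small by blast
  qed
  then have "Restr \<kappa> A \<le>o \<kappa>"
    using not_ordLess_iff_ordLeq[OF woA Well_order] by blast
  then show ?thesis using le ordIso_iff_ordLeq by blast
qed

text \<open>All that is kept of the ideal. The height \<gamma> is that of the nodes to be extended
  simultaneously, and \<beta> makes the common height of the extensions arbitrarily large.\<close>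

locale dense_colour_tree = nice_ranked_tree \<kappa> T r for \<kappa> :: "'a rel" and T :: "'b rel" and r +
  fixes f :: "'b \<Rightarrow> 'a" and c :: 'a and t0 :: 'b
  assumes t0: "t0 \<in> Field T"
    and dense: "\<And>\<beta> \<gamma>. \<beta> \<in> Field \<kappa> \<Longrightarrow> \<gamma> \<in> Field \<kappa> \<Longrightarrow>
      \<exists>\<alpha>. \<beta> \<preceq> \<alpha> \<and> \<gamma> \<preceq> \<alpha> \<and>
        (\<forall>u. (t0, u) \<in> T \<and> r u = \<gamma> \<longrightarrow> (\<exists>v. (u, v) \<in> T \<and> r v = \<alpha> \<and> f v = c))"
begin

section \<open>The levels of the subtree\<close>

definition full :: "'a \<Rightarrow> 'a \<Rightarrow> bool" where
  "full \<gamma> \<alpha> \<longleftrightarrow> \<gamma> \<preceq> \<alpha> \<and>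
     (\<forall>u. (t0, u) \<in> T \<and> r u = \<gamma> \<longrightarrow> (\<exists>v. (u, v) \<in> T \<and> r v = \<alpha> \<and> f v = c))"

definition base :: "'a set \<Rightarrow> 'a" where
  "base B = wo_rel.minim \<kappa> {\<gamma> \<in> Field \<kappa>. r t0 \<preceq> \<gamma> \<and> (\<forall>\<beta>\<in>B. \<beta> \<prec> \<gamma>)}"

lemma rank_t0: "r t0 \<in> Field \<kappa>"
  using rank_Field[OF t0] .

text \<open>The larger of \<alpha> and \<open>r t0\<close> is a candidate, so the minimum is taken
  over a nonempty set.\<close>

lemma base:
  assumes "\<alpha> \<in> Field \<kappa>" "B \<subseteq> underS \<kappa> \<alpha>"
  shows "base B \<in> Field \<kappa>" "r t0 \<preceq> base B" "\<And>\<beta>. \<beta> \<in> B \<Longrightarrow> \<beta> \<prec> base B"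
    "\<And>\<gamma>. r t0 \<preceq> \<gamma> \<Longrightarrow> (\<And>\<beta>. \<beta> \<in> B \<Longrightarrow> \<beta> \<prec> \<gamma>) \<Longrightarrow> base B \<preceq> \<gamma>"
proof -
  let ?G = "{\<gamma> \<in> Field \<kappa>. r t0 \<preceq> \<gamma> \<and> (\<forall>\<beta>\<in>B. \<beta> \<prec> \<gamma>)}"
  have "\<exists>\<gamma>. \<gamma> \<in> ?G"
  proof (cases "r t0 \<preceq> \<alpha>")
    case True
    then show ?thesis using assms by blast
  next
    case False
    then have "\<alpha> \<preceq> r t0" using not_le[OF rank_t0 assms(1)] less_imp_le by simp
    then have "\<forall>\<beta>\<in>B. \<beta> \<prec> r t0" using assms(2) less_le_trans[of _ \<alpha> "r t0"] by auto
    then have "r t0 \<in> ?G" using rank_t0 le_refl[OF rank_t0] by simp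
    then show ?thesis by (rule exI[of _ "r t0"])
  qed
  then have ne: "?G \<noteq> {}" by auto
  have sub: "?G \<subseteq> Field \<kappa>" by auto
  have "base B \<in> ?G"
    unfolding base_def by (rule wo_rel.minim_in[OF wo_rel sub ne])
  then show "base B \<in> Field \<kappa>" "r t0 \<preceq> base B" "\<And>\<beta>. \<beta> \<in> B \<Longrightarrow> \<beta> \<prec> base B"
    by simp_all
  show "base B \<preceq> \<gamma>" if "r t0 \<preceq> \<gamma>" "\<And>\<beta>. \<beta> \<in> B \<Longrightarrow> \<beta> \<prec> \<gamma>" for \<gamma>
    unfolding base_def
    by (rule wo_rel.minim_least[OF wo_rel sub]) (simp add: that le_Field(2)[OF that(1)])
qed

text \<open>The equation refers to \<open>A\<close> on both sides, but on the right only to its part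
  below \<alpha>.\<close>

lemma ex_levels:
  "\<exists>A. \<forall>\<alpha>. \<alpha> \<in> A \<longleftrightarrow> \<alpha> \<in> Field \<kappa> \<and> full (base {\<beta> \<in> A. \<beta> \<prec> \<alpha>}) \<alpha>"
proof -
  have eq: "{y \<in> A. (y, x) \<in> \<kappa> - Id} = {y \<in> A. y \<prec> x}" for A and x :: 'a
    by (auto simp: underS_def)
  obtain A where "\<And>x. x \<in> A \<longleftrightarrow> x \<in> Field \<kappa> \<and> full (base {y \<in> A. (y, x) \<in> \<kappa> - Id}) x"
    by (rule well_founded_subset[OF wo_rel.WF[OF wo_rel],
        of "\<lambda>x B. x \<in> Field \<kappa> \<and> full (base B) x"]) blast
  then show ?thesis unfolding eq by blast
qed

text \<open>
  The set of levels is chosen greedily: a height \<open>\<alpha>\<close> belongs to \<open>A\<close> as soon as it works for all nodes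
  of height \<open>\<sigma> \<alpha>\<close>, where \<open>\<sigma> \<alpha>\<close> is the least height above the earlier elements of \<open>A\<close>. It is the
  height at which the paths through the part of the subtree below \<open>\<alpha>\<close> branch, and covers the
  initial, successor and limit steps at once.
\<close>

definition A :: "'a set" where
  "A = (SOME A. \<forall>\<alpha>. \<alpha> \<in> A \<longleftrightarrow> \<alpha> \<in> Field \<kappa> \<and> full (base {\<beta> \<in> A. \<beta> \<prec> \<alpha>}) \<alpha>)"

abbreviation below :: "'a \<Rightarrow> 'a set" where "below \<alpha> \<equiv> {\<beta> \<in> A. \<beta> \<prec> \<alpha>}"

definition \<sigma> :: "'a \<Rightarrow> 'a" where "\<sigma> \<alpha> = base (below \<alpha>)"

lemma A_iff: "\<alpha> \<in> A \<longleftrightarrow> \<alpha> \<in> Field \<kappa> \<and> full (\<sigma> \<alpha>) \<alpha>"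
proof -
  have "\<forall>\<alpha>. \<alpha> \<in> A \<longleftrightarrow> \<alpha> \<in> Field \<kappa> \<and> full (base (below \<alpha>)) \<alpha>"
    unfolding A_def by (rule someI_ex[OF ex_levels])
  from spec[OF this] show ?thesis unfolding \<sigma>_def .
qed

lemma A_Field: "\<alpha> \<in> A \<Longrightarrow> \<alpha> \<in> Field \<kappa>"
  using A_iff[of \<alpha>] by simp

lemma \<sigma>:
  assumes "\<alpha> \<in> Field \<kappa>"
  shows "\<sigma> \<alpha> \<in> Field \<kappa>" "r t0 \<preceq> \<sigma> \<alpha>" "\<And>\<beta>. \<beta> \<in> A \<Longrightarrow> \<beta> \<prec> \<alpha> \<Longrightarrow> \<beta> \<prec> \<sigma> \<alpha>"
    "\<And>\<gamma>. r t0 \<preceq> \<gamma> \<Longrightarrow> (\<And>\<beta>. \<beta> \<in> A \<Longrightarrow> \<beta> \<prec> \<alpha> \<Longrightarrow> \<beta> \<prec> \<gamma>) \<Longrightarrow> \<sigma> \<alpha> \<preceq> \<gamma>"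
proof -
  have "below \<alpha> \<subseteq> underS \<kappa> \<alpha>" by auto
  note b = base[OF assms this]
  show "\<sigma> \<alpha> \<in> Field \<kappa>" "r t0 \<preceq> \<sigma> \<alpha>" unfolding \<sigma>_def using b(1,2) .
  show "\<beta> \<prec> \<sigma> \<alpha>" if "\<beta> \<in> A" "\<beta> \<prec> \<alpha>" for \<beta>
    unfolding \<sigma>_def by (rule b(3)) (simp add: that)
  show "\<sigma> \<alpha> \<preceq> \<gamma>" if "r t0 \<preceq> \<gamma>" "\<And>\<beta>. \<beta> \<in> A \<Longrightarrow> \<beta> \<prec> \<alpha> \<Longrightarrow> \<beta> \<prec> \<gamma>" for \<gamma>
    unfolding \<sigma>_def by (rule b(4)[OF that(1)]) (simp add: that(2))
qed

lemma \<sigma>_le: "\<alpha> \<in> A \<Longrightarrow> \<sigma> \<alpha> \<preceq> \<alpha>"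
  using A_iff[of \<alpha>] unfolding full_def by simp

lemma rank_t0_le: "\<alpha> \<in> A \<Longrightarrow> r t0 \<preceq> \<alpha>"
  using le_trans[OF \<sigma>(2)[OF A_Field] \<sigma>_le] .

text \<open>Beyond a bound \<open>b\<close> of \<open>A\<close>, all heights have the same earlier
  elements of \<open>A\<close> and hence the same \<sigma>. Density yields a height there that is
  full for this \<sigma>, and the greedy rule would have accepted it.\<close>

lemma A_unbounded:
  assumes "b \<in> Field \<kappa>"
  shows "\<exists>x\<in>A. b \<prec> x"
proof (rule ccontr)
  assume "\<not> ?thesis"
  then have bdd: "x \<preceq> b" if "x \<in> A" for x
    using not_less[OF assms A_Field[OF that]] that by blast
  obtain b' where b': "b \<prec> b'" using ex_greater[OF assms] .
  obtain \<alpha> where \<alpha>: "b' \<preceq> \<alpha>" "full (\<sigma> b') \<alpha>"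
    using dense[OF less_Field(2)[OF b'] \<sigma>(1)[OF less_Field(2)[OF b']]] unfolding full_def by blast
  have "x \<prec> b'" "x \<prec> \<alpha>" if "x \<in> A" for x
    using le_less_trans[OF bdd[OF that] b'] less_le_trans[OF _ \<alpha>(1)] by simp_all
  then have "below b' = below \<alpha>" by auto
  then have "\<alpha> \<in> A"
    using A_iff[of \<alpha>] \<alpha>(2) le_Field(2)[OF \<alpha>(1)] unfolding \<sigma>_def by simp
  from le_less_trans[OF bdd[OF this] less_le_trans[OF b' \<alpha>(1)]]
  show False using less_irrefl by simp
qed

section \<open>The nodes of the subtree\<close>

definition e :: "'b \<Rightarrow> 'a \<Rightarrow> 'b" where
  "e u \<alpha> = (SOME v. (u, v) \<in> T \<and> r v = \<alpha> \<and> f v = c)"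

lemma e:
  assumes "\<alpha> \<in> A" "(t0, u) \<in> T" "r u = \<sigma> \<alpha>"
  shows "(u, e u \<alpha>) \<in> T" "r (e u \<alpha>) = \<alpha>" "f (e u \<alpha>) = c"
proof -
  have "\<exists>v. (u, v) \<in> T \<and> r v = \<alpha> \<and> f v = c"
    using assms A_iff[of \<alpha>] unfolding full_def by blast
  from someI_ex[OF this] show "(u, e u \<alpha>) \<in> T" "r (e u \<alpha>) = \<alpha>" "f (e u \<alpha>) = c"
    unfolding e_def by simp_all
qed

text \<open>When \<open>r w\<close> belongs to \<open>A\<close>, the choice of \<open>e\<close>
  places \<open>u\<close> below \<open>w\<close>; so \<open>w\<close> is the extension picked for
  its own predecessor at height \<open>\<sigma> (r w)\<close>.\<close>

definition chosen :: "'b \<Rightarrow> bool" where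
  "chosen w \<longleftrightarrow> (\<exists>u. (t0, u) \<in> T \<and> r u = \<sigma> (r w) \<and> w = e u (r w))"

text \<open>
  As the extension picked at each level is a function of the node at height \<open>\<sigma> \<alpha>\<close>, the subtree has
  an explicit definition in terms of \<open>A\<close>, without recursion.
\<close>

definition S :: "'b set" where
  "S = {v. (t0, v) \<in> T \<and> r v \<in> A \<and> (\<forall>w. (w, v) \<in> T \<and> r w \<in> A \<longrightarrow> chosen w)}"

lemma S_Field: "S \<subseteq> Field T"
  unfolding S_def using T_Field by auto

lemma S_rank: "v \<in> S \<Longrightarrow> r v \<in> A"
  unfolding S_def by simp

lemma S_chosen:
  assumes "v \<in> S"
  obtains u where "(t0, u) \<in> T" "(u, v) \<in> T" "r u = \<sigma> (r v)" "v = e u (r v)"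
proof -
  have "chosen v" "r v \<in> A"
    using assms T_refl[of v] S_Field unfolding S_def by auto
  then obtain u where u: "(t0, u) \<in> T" "r u = \<sigma> (r v)" "v = e u (r v)"
    unfolding chosen_def by auto
  moreover have "(u, v) \<in> T" using e(1)[OF \<open>r v \<in> A\<close> u(1,2)] u(3) by simp
  ultimately show thesis using that by simp
qed

lemma S_colour: "v \<in> S \<Longrightarrow> f v = c"
  by (metis S_chosen S_rank e(3))

lemma S_downward:
  assumes "v \<in> S" "(w, v) \<in> T" "r w \<in> A"
  shows "w \<in> S"
proof -
  have v: "(t0, v) \<in> T" "\<forall>w. (w, v) \<in> T \<and> r w \<in> A \<longrightarrow> chosen w"
    using assms(1) unfolding S_def by auto
  have "(t0, w) \<in> T"
    using le_iff_rank_le[OF comparable[OF v(1) assms(2)]] rank_t0_le[OF assms(3)] by simp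
  moreover have "\<forall>x. (x, w) \<in> T \<and> r x \<in> A \<longrightarrow> chosen x"
    using v(2) T_trans[OF _ assms(2)] by simp
  ultimately show ?thesis using assms(3) unfolding S_def by simp
qed

text \<open>A node of \<open>S\<close> is a function of its predecessor at height \<sigma>. This
  reduces uniqueness at the root and at limit levels to uniqueness in \<open>T\<close>.\<close>

lemma S_eqI:
  assumes "v \<in> S" "v' \<in> S" "r v = r v'"
    and "\<And>u u'. (t0, u) \<in> T \<Longrightarrow> (u, v) \<in> T \<Longrightarrow> (t0, u') \<in> T \<Longrightarrow> (u', v') \<in> T \<Longrightarrow>
      r u = \<sigma> (r v) \<Longrightarrow> r u' = \<sigma> (r v) \<Longrightarrow> u = u'"
  shows "v = v'"
proof -
  obtain u where u: "(t0, u) \<in> T" "(u, v) \<in> T" "r u = \<sigma> (r v)" "v = e u (r v)"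
    using S_chosen[OF assms(1)] .
  obtain u' where u': "(t0, u') \<in> T" "(u', v') \<in> T" "r u' = \<sigma> (r v')" "v' = e u' (r v')"
    using S_chosen[OF assms(2)] .
  have "u = u'" by (rule assms(4)[OF u(1,2) u'(1,2) u(3)]) (simp add: u'(3) assms(3))
  then show ?thesis using u(4) u'(4) assms(3) by simp
qed

text \<open>All earlier levels lie strictly below \<open>\<sigma> \<alpha>\<close>, the height of
  \<open>u\<close>. The predecessors of \<open>e u \<alpha>\<close> on those levels are therefore
  already predecessors of \<open>u\<close>, and the new node adds no other condition than its own
  choice.\<close>

lemma S_extension:
  assumes \<alpha>: "\<alpha> \<in> A" and u: "(t0, u) \<in> T" "r u = \<sigma> \<alpha>"
    and pred: "\<And>w. (w, u) \<in> T \<Longrightarrow> r w \<in> A \<Longrightarrow> r w \<prec> \<alpha> \<Longrightarrow> w \<in> S"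
  shows "\<exists>!v. v \<in> S \<and> r v = \<alpha> \<and> (u, v) \<in> T"
proof
  note eu = e[OF \<alpha> u]
  have "chosen w" if w: "(w, e u \<alpha>) \<in> T" "r w \<in> A" for w
  proof (cases "w = e u \<alpha>")
    case True
    then show ?thesis unfolding chosen_def using u eu(2) by auto
  next
    case False
    then have less: "r w \<prec> \<alpha>" using rank_less[of w "e u \<alpha>"] w(1) eu(2) by (simp add: underS_def)
    then have "r w \<prec> r u" using \<sigma>(3)[OF A_Field[OF \<alpha>] w(2)] u(2) by simp
    then have "(w, u) \<in> T"
      using le_iff_rank_le[OF comparable[OF w(1) eu(1)]] less_imp_le by simp
    then have "w \<in> S" using pred w(2) less by simp
    then show ?thesis unfolding S_def using T_refl[OF T_Field(1)[OF w(1)]] w(2) by simp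
  qed
  then show "e u \<alpha> \<in> S \<and> r (e u \<alpha>) = \<alpha> \<and> (u, e u \<alpha>) \<in> T"
    using eu T_trans[OF u(1) eu(1)] \<alpha> unfolding S_def by simp
  fix v assume v: "v \<in> S \<and> r v = \<alpha> \<and> (u, v) \<in> T"
  then have vS: "v \<in> S" and rv: "r v = \<alpha>" and uv: "(u, v) \<in> T" by simp_all
  obtain u' where u': "(t0, u') \<in> T" "(u', v) \<in> T" "r u' = \<sigma> (r v)" "v = e u' (r v)"
    using S_chosen[OF vS] .
  have "u' = u" by (rule eq_if_rank_eq[OF comparable[OF u'(2) uv]]) (simp add: u'(3) u(2) rv)
  then show "v = e u \<alpha>" using u'(4) rv by simp
qed

lemma S_chain_extension:
  assumes C: "C \<in> Chains T" "C \<subseteq> S" and \<alpha>: "\<alpha> \<in> A" and rC: "r ` C = below \<alpha>"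
  shows "\<exists>v. v \<in> S \<and> r v = \<alpha> \<and> (\<forall>x\<in>C. (x, v) \<in> T)"
proof -
  have t0C: "(t0, x) \<in> T" if "x \<in> C" for x
    using C(2) that unfolding S_def by auto
  \<comment> \<open>Inserting \<open>t0\<close> puts the upper bound above \<open>t0\<close> even
    when \<open>C\<close> is empty, which is the case of the root.\<close>
  have "insert t0 C \<in> Chains T"
    using C(1) t0C T_refl[OF t0] unfolding Chains_def by auto
  moreover have "r t \<preceq> \<sigma> \<alpha>" if "t \<in> insert t0 C" for t
  proof (cases "t = t0")
    case True
    then show ?thesis using \<sigma>(2)[OF A_Field[OF \<alpha>]] by simp
  next
    case False
    then have "r t \<in> below \<alpha>" using that rC by auto
    then show ?thesis using \<sigma>(3)[OF A_Field[OF \<alpha>], of "r t"] less_imp_le by simp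
  qed
  ultimately obtain u where u: "r u = \<sigma> \<alpha>" "\<forall>t\<in>insert t0 C. (t, u) \<in> T"
    using chain_upper_bound[OF _ \<sigma>(1)[OF A_Field[OF \<alpha>]], of "insert t0 C"] by metis
  have "w \<in> S" if w: "(w, u) \<in> T" "r w \<in> A" "r w \<prec> \<alpha>" for w
  proof -
    have "r w \<in> r ` C" using rC w by simp
    then obtain x where x: "x \<in> C" "r w = r x" by auto
    have "(x, u) \<in> T" using u(2) x(1) by simp
    then have "w = x" using eq_if_rank_eq[OF comparable[OF w(1)]] x(2) by simp
    then show ?thesis using x(1) C(2) by auto
  qed
  then have "\<exists>!v. v \<in> S \<and> r v = \<alpha> \<and> (u, v) \<in> T"
    using S_extension[OF \<alpha> _ u(1)] u(2) by simp
  then obtain v where v: "v \<in> S" "r v = \<alpha>" "(u, v) \<in> T" by auto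
  have "\<forall>x\<in>C. (x, v) \<in> T" using u(2) T_trans[OF _ v(3)] by simp
  then show ?thesis using v by auto
qed

text \<open>The level of \<open>s\<close> is the last one before \<alpha>, so
  \<open>\<sigma> \<alpha>\<close> is exactly one more than \<open>r s\<close>: the immediate
  successors of \<open>s\<close> in \<open>T\<close> are the nodes at which extensions are picked.
  If \<alpha> itself is this height, the extension of \<open>u\<close> is \<open>u\<close>.\<close>

lemma S_Succ_extension:
  assumes s: "s \<in> S" and u: "u \<in> Succ T s" and \<alpha>: "\<alpha> \<in> A"
    and next_level: "\<And>\<beta>. \<beta> \<in> A \<Longrightarrow> \<beta> \<prec> \<alpha> \<longleftrightarrow> \<beta> \<preceq> r s"
  shows "\<exists>!v. v \<in> S \<and> r v = \<alpha> \<and> (u, v) \<in> T"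
proof (rule S_extension[OF \<alpha>])
  have sT: "s \<in> Field T" "r s \<in> A" "r s \<in> Field \<kappa>"
    using s S_Field S_rank A_Field by auto
  have su: "(s, u) \<in> T" using u unfolding Succ_def aboveS_def by simp
  show "(t0, u) \<in> T" using s T_trans[OF _ su] unfolding S_def by simp
  have ru: "r u = wo_rel.suc \<kappa> {r s}" using rank_Succ[OF u] .
  have "r s \<prec> \<alpha>" using next_level[OF sT(2)] le_refl[OF sT(3)] by simp
  have "\<sigma> \<alpha> \<preceq> r u"
  proof (rule \<sigma>(4)[OF A_Field[OF \<alpha>]])
    show "r t0 \<preceq> r u" using rank_le[OF \<open>(t0, u) \<in> T\<close>] .
    show "\<beta> \<prec> r u" if "\<beta> \<in> A" "\<beta> \<prec> \<alpha>" for \<beta>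
      using that next_level less_suc_iff[OF sT(3)] ru by simp
  qed
  moreover have "r u \<preceq> \<sigma> \<alpha>"
    unfolding ru using suc(2)[OF sT(3) \<sigma>(3)[OF A_Field[OF \<alpha>] sT(2) \<open>r s \<prec> \<alpha>\<close>]] .
  ultimately show "r u = \<sigma> \<alpha>" using le_antisym by simp
  show "w \<in> S" if w: "(w, u) \<in> T" "r w \<in> A" "r w \<prec> \<alpha>" for w
  proof (rule S_downward[OF s _ w(2)])
    show "(w, s) \<in> T"
      using le_iff_rank_le[OF comparable[OF w(1) su]] next_level[OF w(2)] w(3) by simp
  qed
qed

section \<open>The enumeration of the levels and heights in the subtree\<close>

lemma ex_enumeration: "\<exists>a. iso \<kappa> (Restr \<kappa> A) a"
proof -
  have "A \<subseteq> Field \<kappa>" using A_Field by auto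
  then have "Restr \<kappa> A =o \<kappa>"
    using Restr_ordIso_if_card unbounded_card A_unbounded by simp
  from ordIso_symmetric[OF this] show ?thesis unfolding ordIso_def by simp
qed

definition a :: "'a \<Rightarrow> 'a" where "a = (SOME a. iso \<kappa> (Restr \<kappa> A) a)"

lemma iso_a: "iso \<kappa> (Restr \<kappa> A) a"
  unfolding a_def by (rule someI_ex[OF ex_enumeration])

lemma bij_a: "bij_betw a (Field \<kappa>) A"
proof -
  have "A \<subseteq> Field \<kappa>" using A_Field by auto
  then have "Field (Restr \<kappa> A) = A"
    by (rule Refl_Field_Restr2[OF wo_rel.REFL[OF wo_rel]])
  then show ?thesis using iso_a unfolding iso_iff2 by simp
qed

lemma a_A: "\<xi> \<in> Field \<kappa> \<Longrightarrow> a \<xi> \<in> A"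
  using bij_a unfolding bij_betw_def by auto

lemma a_eq_iff: "\<xi> \<in> Field \<kappa> \<Longrightarrow> \<eta> \<in> Field \<kappa> \<Longrightarrow> a \<xi> = a \<eta> \<longleftrightarrow> \<xi> = \<eta>"
  using bij_a unfolding bij_betw_def by (auto dest: inj_onD)

lemma a_le_iff: "\<xi> \<in> Field \<kappa> \<Longrightarrow> \<eta> \<in> Field \<kappa> \<Longrightarrow> a \<xi> \<preceq> a \<eta> \<longleftrightarrow> \<xi> \<preceq> \<eta>"
  using iso_a a_A unfolding iso_iff2 by auto

lemma a_less_iff: "\<xi> \<in> Field \<kappa> \<Longrightarrow> \<eta> \<in> Field \<kappa> \<Longrightarrow> a \<xi> \<prec> a \<eta> \<longleftrightarrow> \<xi> \<prec> \<eta>"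
  using a_le_iff[of \<xi> \<eta>] a_eq_iff[of \<xi> \<eta>] unfolding underS_def by simp

text \<open>The height inside the subtree: the index of the level on which the node lies.\<close>

definition \<rho> :: "'b \<Rightarrow> 'a" where "\<rho> v = inv_into (Field \<kappa>) a (r v)"

lemma \<rho>:
  assumes "v \<in> S"
  shows "\<rho> v \<in> Field \<kappa>" "a (\<rho> v) = r v"
proof -
  have "r v \<in> a ` Field \<kappa>" using S_rank[OF assms] bij_a unfolding bij_betw_def by simp
  then show "\<rho> v \<in> Field \<kappa>" "a (\<rho> v) = r v"
    unfolding \<rho>_def by (rule inv_into_into, rule f_inv_into_f)
qed

lemma \<rho>_eq_iff: "v \<in> S \<Longrightarrow> \<xi> \<in> Field \<kappa> \<Longrightarrow> \<rho> v = \<xi> \<longleftrightarrow> r v = a \<xi>"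
  using \<rho>[of v] a_eq_iff[of "\<rho> v" \<xi>] by simp

lemma \<rho>_less_iff: "v \<in> S \<Longrightarrow> w \<in> S \<Longrightarrow> \<rho> v \<prec> \<rho> w \<longleftrightarrow> r v \<prec> r w"
  using \<rho>[of v] \<rho>[of w] a_less_iff[of "\<rho> v" "\<rho> w"] by simp

lemma Field_Restr_S: "Field (Restr T S) = S"
  using Partial_order S_Field unfolding order_on_defs by (intro Refl_Field_Restr2) simp_all

text \<open>\<open>S\<close> contains the predecessors of its nodes at all heights in
  \<open>A\<close>, so the predecessors of \<open>t\<close> in \<open>S\<close> occupy every level
  of the subtree before that of \<open>t\<close>.\<close>

lemma rank_function_S: "rank_function \<kappa> (Restr T S) \<rho>"
  unfolding rank_function_def Field_Restr_S
proof (intro conjI allI ballI impI)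
  show "partial_order_on S (Restr T S)"
    using Partial_order_Restr[OF Partial_order, of S] unfolding Field_Restr_S .
  show "\<rho> ` S \<subseteq> Field \<kappa>" using \<rho>(1) by auto
  show "(s, t) \<in> Restr T S \<or> (t, s) \<in> Restr T S"
    if "(s, u) \<in> Restr T S \<and> (t, u) \<in> Restr T S" for s t u
    using that comparable[of s u t] by auto
  show "\<rho> ` underS (Restr T S) t = underS \<kappa> (\<rho> t)" if t: "t \<in> S" for t
  proof (intro equalityI subsetI)
    fix \<xi> assume "\<xi> \<in> \<rho> ` underS (Restr T S) t"
    then obtain s where s: "s \<in> S" "s \<in> underS T t" "\<xi> = \<rho> s" by (auto simp: underS_def)
    then show "\<xi> \<prec> \<rho> t" using \<rho>_less_iff[OF s(1) t] rank_less[OF s(2)] by simp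
  next
    fix \<xi> assume \<xi>: "\<xi> \<prec> \<rho> t"
    then have "a \<xi> \<prec> r t"
      using a_less_iff[OF less_Field(1)[OF \<xi>] \<rho>(1)[OF t]] \<rho>(2)[OF t] by simp
    moreover have "t \<in> Field T" using t S_Field by auto
    ultimately obtain s where s: "(s, t) \<in> T" "r s = a \<xi>"
      using ex_predecessor[OF _ less_imp_le] by metis
    have sS: "s \<in> S"
      using S_downward[OF t s(1)] s(2) a_A[OF less_Field(1)[OF \<xi>]] by simp
    have "\<rho> s = \<xi>" using \<rho>_eq_iff[OF sS less_Field(1)[OF \<xi>]] s(2) by simp
    moreover from this have "s \<noteq> t" using \<xi> less_irrefl by auto
    ultimately show "\<xi> \<in> \<rho> ` underS (Restr T S) t"
      using s(1) sS t by (auto simp: underS_def)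
  qed
qed

sublocale sub: ranked_tree \<kappa> "Restr T S" \<rho>
  using rank_function_S by unfold_locales

lemma sub_level: "\<xi> \<in> Field \<kappa> \<Longrightarrow> level \<kappa> (Restr T S) \<xi> = {v \<in> S. r v = a \<xi>}"
  using sub.level_eq[of \<xi>] \<rho>_eq_iff unfolding Field_Restr_S by auto

text \<open>An increasing enumeration of \<open>A\<close> skips no element: the value at a successor
  index is the next element of \<open>A\<close>.\<close>

lemma less_a_suc_iff:
  assumes "\<xi> \<in> Field \<kappa>" "\<beta> \<in> A"
  shows "\<beta> \<prec> a (wo_rel.suc \<kappa> {\<xi>}) \<longleftrightarrow> \<beta> \<preceq> a \<xi>"
proof -
  have "\<beta> \<in> a ` Field \<kappa>" using bij_a assms(2) unfolding bij_betw_def by simp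
  then obtain \<eta> where "\<eta> \<in> Field \<kappa>" "\<beta> = a \<eta>" by auto
  moreover have "wo_rel.suc \<kappa> {\<xi>} \<in> Field \<kappa>" using less_Field(2)[OF suc(1)[OF assms(1)]] .
  ultimately show ?thesis
    using a_less_iff a_le_iff assms(1) less_suc_iff by simp
qed

lemma sub_Succ_extension:
  assumes \<xi>: "\<xi> \<in> Field \<kappa>" and s: "s \<in> S" "r s = a \<xi>" and u: "u \<in> Succ T s"
  shows "\<exists>!v. v \<in> level \<kappa> (Restr T S) (wo_rel.suc \<kappa> {\<xi>}) \<and> (u, v) \<in> T"
proof -
  have suc_Field: "wo_rel.suc \<kappa> {\<xi>} \<in> Field \<kappa>" using less_Field(2)[OF suc(1)[OF \<xi>]] .
  have "\<exists>!v. v \<in> S \<and> r v = a (wo_rel.suc \<kappa> {\<xi>}) \<and> (u, v) \<in> T"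
    by (rule S_Succ_extension[OF s(1) u a_A[OF suc_Field]]) (simp add: less_a_suc_iff[OF \<xi>] s(2))
  then show ?thesis unfolding sub_level[OF suc_Field] by simp
qed

section \<open>Niceness of the subtree\<close>

lemma S_maximal_path:
  assumes M: "maximal_path (Restr T S) M"
  shows "\<rho> ` M = Field \<kappa>"
proof (rule ccontr)
  assume ne: "\<rho> ` M \<noteq> Field \<kappa>"
  have cmp: "(x, y) \<in> Restr T S \<or> (y, x) \<in> Restr T S" if "x \<in> M" "y \<in> M" for x y
    using M that unfolding maximal_path_def Chains_def by blast
  then have MS: "M \<subseteq> S" by auto
  \<comment> \<open>Let \<xi> be the least missing index. As the path is closed downwards in
    \<open>S\<close>, it occupies exactly the levels before \<xi>; then some node of
    \<open>S\<close> on level \<open>a \<xi>\<close> prolongs it.\<close>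
  define E where "E = Field \<kappa> - \<rho> ` M"
  have "E \<noteq> {}" using ne \<rho>(1) MS unfolding E_def by auto
  moreover have E: "E \<subseteq> Field \<kappa>" unfolding E_def by auto
  ultimately obtain \<xi> where \<xi>: "\<xi> \<in> E" "\<And>\<eta>. \<eta> \<in> E \<Longrightarrow> \<xi> \<preceq> \<eta>"
    using wo_rel.minim_in[OF wo_rel E] wo_rel.minim_least[OF wo_rel E] by metis
  have \<xi>F: "\<xi> \<in> Field \<kappa>" "\<xi> \<notin> \<rho> ` M" using \<xi>(1) unfolding E_def by auto
  have above: "\<rho> x \<prec> \<xi>" if x: "x \<in> M" for x
  proof (rule ccontr)
    have xS: "x \<in> S" using x MS by auto
    assume "\<not> \<rho> x \<prec> \<xi>"
    then have "\<xi> \<preceq> \<rho> x" using not_less[OF \<rho>(1)[OF xS] \<xi>F(1)] by simp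
    moreover have "x \<in> Field (Restr T S)" using xS Field_Restr_S by simp
    ultimately obtain w where w: "(w, x) \<in> Restr T S" "\<rho> w = \<xi>"
      using sub.ex_predecessor by metis
    have "w \<in> M" using sub.maximal_path_downward[OF M x w(1)] .
    then show False using w(2) \<xi>F(2) by auto
  qed
  have rM: "r ` M = below (a \<xi>)"
  proof (intro equalityI subsetI)
    fix \<beta> assume "\<beta> \<in> r ` M"
    then obtain x where x: "x \<in> M" "\<beta> = r x" by auto
    then have xS: "x \<in> S" using MS by auto
    then show "\<beta> \<in> below (a \<xi>)"
      using x(2) S_rank[OF xS] a_less_iff[OF \<rho>(1)[OF xS] \<xi>F(1)] \<rho>(2)[OF xS] above[OF x(1)] by simp
  next
    fix \<beta> assume \<beta>: "\<beta> \<in> below (a \<xi>)"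
    then have "\<beta> \<in> a ` Field \<kappa>" using bij_a unfolding bij_betw_def by simp
    then obtain \<eta> where \<eta>: "\<eta> \<in> Field \<kappa>" "\<beta> = a \<eta>" by auto
    then have "\<eta> \<prec> \<xi>" using \<beta> a_less_iff[OF \<eta>(1) \<xi>F(1)] by simp
    then have "\<eta> \<notin> E" using \<xi>(2) not_le[OF \<xi>F(1) \<eta>(1)] by auto
    then obtain x where x: "x \<in> M" "\<eta> = \<rho> x" using \<eta>(1) unfolding E_def by auto
    then have "\<beta> = r x" using \<eta>(2) \<rho>(2) MS by auto
    then show "\<beta> \<in> r ` M" using x(1) by auto
  qed
  have "M \<in> Chains T" using cmp unfolding Chains_def by auto
  then obtain v where v: "v \<in> S" "r v = a \<xi>" "\<forall>x\<in>M. (x, v) \<in> T"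
    using S_chain_extension[OF _ MS a_A[OF \<xi>F(1)] rM] by auto
  have "(v, v) \<in> T" using T_refl v(1) S_Field by auto
  then have "insert v M \<in> Chains (Restr T S)"
    using cmp v MS unfolding Chains_def by auto
  then have "insert v M = M" using M unfolding maximal_path_def by auto
  then have "v \<in> M" by auto
  moreover have "\<rho> v = \<xi>" using \<rho>_eq_iff[OF v(1) \<xi>F(1)] v(2) by simp
  ultimately show False using \<xi>F(2) by auto
qed

text \<open>The least element of \<open>A\<close> has no earlier levels, so its \<sigma> is
  \<open>r t0\<close>. The only node above \<open>t0\<close> at that height is \<open>t0\<close>
  itself, which leaves one choice.\<close>

lemma S_unique_root: "\<exists>!t. t \<in> S \<and> underS (Restr T S) t = {}"
proof -
  have root_iff: "underS (Restr T S) t = {} \<longleftrightarrow> below (r t) = {}" if t: "t \<in> S" for t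
  proof -
    have "underS (Restr T S) t = {} \<longleftrightarrow> underS \<kappa> (\<rho> t) = {}"
      using sub.rank_underS[of t] t unfolding Field_Restr_S by auto
    moreover have "below (r t) = a ` underS \<kappa> (\<rho> t)"
    proof (intro equalityI subsetI)
      fix \<beta> assume \<beta>: "\<beta> \<in> below (r t)"
      then have "\<beta> \<in> a ` Field \<kappa>" using bij_a unfolding bij_betw_def by simp
      then obtain \<eta> where \<eta>: "\<eta> \<in> Field \<kappa>" "\<beta> = a \<eta>" by auto
      then show "\<beta> \<in> a ` underS \<kappa> (\<rho> t)"
        using \<beta> a_less_iff[OF \<eta>(1) \<rho>(1)[OF t]] \<rho>(2)[OF t] by simp
    next
      fix \<beta> assume "\<beta> \<in> a ` underS \<kappa> (\<rho> t)"
      then obtain \<eta> where \<eta>: "\<eta> \<prec> \<rho> t" "\<beta> = a \<eta>" by auto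
      then show "\<beta> \<in> below (r t)"
        using a_less_iff[OF less_Field[OF \<eta>(1)]] a_A[OF less_Field(1)[OF \<eta>(1)]] \<rho>(2)[OF t] by simp
    qed
    ultimately show ?thesis by simp
  qed
  have A: "A \<subseteq> Field \<kappa>" "A \<noteq> {}" using A_Field A_unbounded[OF rank_t0] by auto
  define \<alpha> where "\<alpha> = wo_rel.minim \<kappa> A"
  have \<alpha>: "\<alpha> \<in> A" "\<And>\<beta>. \<beta> \<in> A \<Longrightarrow> \<alpha> \<preceq> \<beta>"
    unfolding \<alpha>_def using wo_rel.minim_in[OF wo_rel A] wo_rel.minim_least[OF wo_rel A(1)] by simp_all
  have below_iff: "below \<beta> = {} \<longleftrightarrow> \<beta> = \<alpha>" if \<beta>: "\<beta> \<in> A" for \<beta>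
  proof
    assume "below \<beta> = {}"
    then have "\<not> \<alpha> \<prec> \<beta>" using \<alpha>(1) by auto
    then show "\<beta> = \<alpha>" using \<alpha>(2)[OF \<beta>] by (simp add: underS_def)
  next
    assume "\<beta> = \<alpha>"
    have "\<not> \<gamma> \<prec> \<alpha>" if "\<gamma> \<in> A" for \<gamma>
      using not_le[OF A_Field[OF \<alpha>(1)] A_Field[OF that]] \<alpha>(2)[OF that] by simp
    then show "below \<beta> = {}" using \<open>\<beta> = \<alpha>\<close> by auto
  qed
  have "\<sigma> \<alpha> \<preceq> r t0"
    using \<sigma>(4)[OF A_Field[OF \<alpha>(1)] le_refl[OF rank_t0]] below_iff[OF \<alpha>(1)] by auto
  then have \<sigma>\<alpha>: "\<sigma> \<alpha> = r t0"
    using \<sigma>(2)[OF A_Field[OF \<alpha>(1)]] le_antisym by simp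
  have "{} \<in> Chains T" "r ` {} = below \<alpha>"
    using below_iff[OF \<alpha>(1)] by (auto simp: Chains_def)
  then obtain v where v: "v \<in> S" "r v = \<alpha>"
    using S_chain_extension[OF _ _ \<alpha>(1)] by blast
  show ?thesis
  proof (rule ex1I[of _ v])
    show "v \<in> S \<and> underS (Restr T S) v = {}"
      using root_iff[OF v(1)] below_iff[OF \<alpha>(1)] v by simp
    fix t assume t: "t \<in> S \<and> underS (Restr T S) t = {}"
    then have rt: "r t = \<alpha>" using root_iff[of t] below_iff[OF S_rank[of t]] by simp
    show "t = v"
    proof (rule S_eqI)
      show "t \<in> S" "v \<in> S" "r t = r v" using t v rt by simp_all
      fix u u'
      assume u: "(t0, u) \<in> T" "(t0, u') \<in> T" "r u = \<sigma> (r t)" "r u' = \<sigma> (r t)"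
      have "t0 = u" by (rule eq_if_rank_eq) (simp_all add: u rt \<sigma>\<alpha>)
      moreover have "t0 = u'" by (rule eq_if_rank_eq) (simp_all add: u rt \<sigma>\<alpha>)
      ultimately show "u = u'" by simp
    qed
  qed
qed

text \<open>At a limit index \<xi>, \<sigma> of \<open>a \<xi>\<close> is the supremum of the
  earlier levels and a limit ordinal. Predecessors in \<open>S\<close> are cofinal below a node of
  \<open>T\<close> at that height, so they determine its predecessors in \<open>T\<close>, and
  niceness of \<open>T\<close> identifies the node.\<close>

lemma S_limit_unique:
  assumes lim: "limit_ordinal \<kappa> \<xi>" and s: "s \<in> S" "r s = a \<xi>" and t: "t \<in> S" "r t = a \<xi>"
    and eq: "underS (Restr T S) s = underS (Restr T S) t"
  shows "s = t"
proof (rule S_eqI[OF s(1) t(1)])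
  have \<xi>: "\<xi> \<in> Field \<kappa>" using lim unfolding limit_ordinal_def by simp
  show "r s = r t" using s t by simp
  let ?\<gamma> = "\<sigma> (a \<xi>)"
  have F: "a \<xi> \<in> Field \<kappa>" using A_Field[OF a_A[OF \<xi>]] .
  \<comment> \<open>Otherwise \<beta> would be a smaller strict upper bound of the earlier levels;
    as at least one such level exists, \<beta> is also at least \<open>r t0\<close>, against the
    minimality in \<sigma>.\<close>
  have cofinal: "\<exists>\<eta>. \<eta> \<prec> \<xi> \<and> \<beta> \<preceq> a \<eta>" if \<beta>: "\<beta> \<prec> ?\<gamma>" for \<beta>
  proof (rule ccontr)
    assume "\<not> ?thesis"
    then have less: "a \<eta> \<prec> \<beta>" if "\<eta> \<prec> \<xi>" for \<eta>
      using not_le[OF less_Field(1)[OF \<beta>] A_Field[OF a_A[OF less_Field(1)[OF that]]]] that by auto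
    obtain \<eta>0 where \<eta>0: "\<eta>0 \<prec> \<xi>" using lim unfolding limit_ordinal_def by auto
    have "r t0 \<preceq> \<beta>"
      using le_trans[OF rank_t0_le[OF a_A[OF less_Field(1)[OF \<eta>0]]] less_imp_le[OF less[OF \<eta>0]]] .
    moreover have "\<alpha> \<prec> \<beta>" if \<alpha>: "\<alpha> \<in> A" "\<alpha> \<prec> a \<xi>" for \<alpha>
    proof -
      have "\<alpha> \<in> a ` Field \<kappa>" using bij_a \<alpha>(1) unfolding bij_betw_def by simp
      then obtain \<eta> where \<eta>: "\<eta> \<in> Field \<kappa>" "\<alpha> = a \<eta>" by auto
      then show ?thesis using \<alpha>(2) a_less_iff[OF \<eta>(1) \<xi>] less by simp
    qed
    ultimately have "?\<gamma> \<preceq> \<beta>" using \<sigma>(4)[OF F] by simp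
    from le_less_trans[OF this \<beta>] show False using less_irrefl by simp
  qed
  have a_less: "a \<eta> \<prec> ?\<gamma>" if "\<eta> \<prec> \<xi>" for \<eta>
    using \<sigma>(3)[OF F a_A[OF less_Field(1)[OF that]]] a_less_iff[OF less_Field(1)[OF that] \<xi>] that by simp
  obtain \<eta>0 where \<eta>0: "\<eta>0 \<prec> \<xi>" using lim unfolding limit_ordinal_def by auto
  have lim_\<gamma>: "limit_ordinal \<kappa> ?\<gamma>"
  proof (rule limit_ordinalI[OF a_less[OF \<eta>0]])
    fix \<beta> assume "\<beta> \<prec> ?\<gamma>"
    then obtain \<eta> where \<eta>: "\<eta> \<prec> \<xi>" "\<beta> \<preceq> a \<eta>" using cofinal by auto
    note suc = limit_ordinal_between[OF lim \<eta>(1)]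
    have "a \<eta> \<prec> a (wo_rel.suc \<kappa> {\<eta>})"
      using a_less_iff[OF less_Field[OF suc(1)]] suc(1) by simp
    then show "\<exists>\<gamma>. \<beta> \<prec> \<gamma> \<and> \<gamma> \<prec> ?\<gamma>"
      using le_less_trans[OF \<eta>(2)] a_less[OF suc(2)] by auto
  qed
  \<comment> \<open>A predecessor \<open>w\<close> of \<open>u\<close> lies below some
    \<open>p\<close> of \<open>S\<close> under \<open>x\<close>. This \<open>p\<close> is also under
    \<open>y\<close>, hence below \<open>u'\<close> by its height. Stated for general
    \<open>x\<close> and \<open>y\<close>, the inclusion can be used in both directions.\<close>
  have sub: "underS T u \<subseteq> underS T u'"
    if u: "(u, x) \<in> T" "(u', y) \<in> T" "r u = ?\<gamma>" "r u' = ?\<gamma>"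
      and x: "x \<in> S" "r x = a \<xi>" and eq: "underS (Restr T S) x = underS (Restr T S) y"
    for u u' x y
  proof
    fix w assume w: "w \<in> underS T u"
    then have wu: "(w, u) \<in> T" by (simp add: underS_def)
    obtain \<eta> where \<eta>: "\<eta> \<prec> \<xi>" "r w \<preceq> a \<eta>"
      using cofinal[of "r w"] rank_less[OF w] u(3) by auto
    have "a \<eta> \<prec> r x" using a_less_iff[OF less_Field(1)[OF \<eta>(1)] \<xi>] \<eta>(1) x(2) by simp
    moreover have "x \<in> Field T" using x(1) S_Field by auto
    ultimately obtain p where p: "(p, x) \<in> T" "r p = a \<eta>"
      using ex_predecessor[OF _ less_imp_le] by metis
    have "p \<in> S" using S_downward[OF x(1) p(1)] p(2) a_A[OF less_Field(1)[OF \<eta>(1)]] by simp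
    moreover have "p \<noteq> x" using \<open>a \<eta> \<prec> r x\<close> p(2) less_irrefl by auto
    ultimately have "p \<in> underS (Restr T S) x" using p(1) x(1) by (simp add: underS_def)
    then have "p \<in> underS (Restr T S) y" unfolding eq .
    then have py: "(p, y) \<in> T" by (simp add: underS_def)
    have "(p, u') \<in> T"
      using le_iff_rank_le[OF comparable[OF py u(2)]] less_imp_le[OF a_less[OF \<eta>(1)]] p(2) u(4) by simp
    moreover have "(w, p) \<in> T"
      using le_iff_rank_le[OF comparable[OF T_trans[OF wu u(1)] p(1)]] \<eta>(2) p(2) by simp
    ultimately have "(w, u') \<in> T" using T_trans by blast
    moreover have "w \<noteq> u'" using rank_less[OF w] u(3,4) less_irrefl by auto
    ultimately show "w \<in> underS T u'" by (simp add: underS_def)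
  qed
  fix u u'
  assume u: "(u, s) \<in> T" "(u', t) \<in> T" "r u = \<sigma> (r s)" "r u' = \<sigma> (r s)"
  then have ru: "r u = ?\<gamma>" "r u' = ?\<gamma>" using s(2) by simp_all
  show "u = u'"
  proof (rule limit_level_unique)
    show "limit_ordinal \<kappa> (r u)" "r u = r u'" using lim_\<gamma> ru by simp_all
    show "u \<in> Field T" "u' \<in> Field T" using T_Field(1) u by blast+
    show "underS T u = underS T u'"
      using sub[OF u(1,2) ru s eq] sub[OF u(2,1) ru(2,1) t eq[symmetric]] by (rule equalityI)
  qed
qed

text \<open>Two incomparable immediate successors in \<open>T\<close> extend to the next level of
  \<open>S\<close>. A common extension would make them comparable, and distinct nodes of equal rank
  are incomparable.\<close>

lemma S_incomparable_Succ:
  assumes t: "t \<in> S"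
  shows "\<exists>u\<in>Succ (Restr T S) t. \<exists>v\<in>Succ (Restr T S) t. (u, v) \<notin> Restr T S \<and> (v, u) \<notin> Restr T S"
proof -
  have "t \<in> Field T" using t S_Field by auto
  then obtain u u' where u: "u \<in> Succ T t" "u' \<in> Succ T t" "(u, u') \<notin> T" "(u', u) \<notin> T"
    using ex_incomparable_Succ by metis
  have \<xi>: "\<rho> t \<in> Field \<kappa>" "r t = a (\<rho> t)" using \<rho>[OF t] by simp_all
  have suc_Field: "wo_rel.suc \<kappa> {\<rho> t} \<in> Field \<kappa>" using less_Field(2)[OF suc(1)[OF \<xi>(1)]] .
  have ext: "\<exists>v. v \<in> Succ (Restr T S) t \<and> (x, v) \<in> T \<and> r v = a (wo_rel.suc \<kappa> {\<rho> t})"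
    if x: "x \<in> Succ T t" for x
  proof -
    obtain v where v: "v \<in> S" "r v = a (wo_rel.suc \<kappa> {\<rho> t})" "(x, v) \<in> T"
      using sub_Succ_extension[OF \<xi>(1) t \<xi>(2) x] unfolding sub_level[OF suc_Field] by auto
    have "(t, x) \<in> T" using x unfolding Succ_def aboveS_def by simp
    then have "(t, v) \<in> Restr T S" using T_trans[OF _ v(3)] t v(1) by simp
    moreover have "\<rho> v = wo_rel.suc \<kappa> {\<rho> t}" using \<rho>_eq_iff[OF v(1) suc_Field] v(2) by simp
    ultimately have "v \<in> Succ (Restr T S) t" by (rule sub.SuccI)
    then show ?thesis using v by auto
  qed
  obtain v where v: "v \<in> Succ (Restr T S) t" "(u, v) \<in> T" "r v = a (wo_rel.suc \<kappa> {\<rho> t})"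
    using ext[OF u(1)] by auto
  obtain v' where v': "v' \<in> Succ (Restr T S) t" "(u', v') \<in> T" "r v' = a (wo_rel.suc \<kappa> {\<rho> t})"
    using ext[OF u(2)] by auto
  have "v \<noteq> v'" using comparable[OF v(2), of u'] v'(2) u(3,4) by auto
  then have "(v, v') \<notin> T" "(v', v) \<notin> T"
    using eq_if_rank_eq[of v v'] v(3) v'(3) by auto
  then show ?thesis using v(1) v'(1) by auto
qed

lemma nice_S: "nice_tree \<kappa> (Restr T S)"
  unfolding sub.nice_tree_iff Field_Restr_S
proof (intro conjI)
  show "\<exists>!t. t \<in> S \<and> underS (Restr T S) t = {}" by (rule S_unique_root)
  show "\<forall>M. maximal_path (Restr T S) M \<longrightarrow> \<rho> ` M = Field \<kappa>"
    using S_maximal_path by simp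
  show "\<forall>t\<in>S. \<exists>u\<in>Succ (Restr T S) t. \<exists>v\<in>Succ (Restr T S) t.
      (u, v) \<notin> Restr T S \<and> (v, u) \<notin> Restr T S"
    by (rule ballI) (rule S_incomparable_Succ)
  show "\<forall>\<xi>\<in>Field \<kappa>. |level \<kappa> (Restr T S) \<xi>| <o \<kappa>"
  proof
    fix \<xi> assume \<xi>: "\<xi> \<in> Field \<kappa>"
    have "{v \<in> S. r v = a \<xi>} \<subseteq> {t \<in> Field T. r t = a \<xi>}" using S_Field by auto
    from ordLeq_ordLess_trans[OF card_of_mono1[OF this] card_level[OF A_Field[OF a_A[OF \<xi>]]]]
    show "|level \<kappa> (Restr T S) \<xi>| <o \<kappa>" unfolding sub_level[OF \<xi>] .
  qed
  show "\<forall>\<xi>. limit_ordinal \<kappa> \<xi> \<longrightarrow>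
    (\<forall>s\<in>level \<kappa> (Restr T S) \<xi>. \<forall>t\<in>level \<kappa> (Restr T S) \<xi>.
      underS (Restr T S) s = underS (Restr T S) t \<longrightarrow> s = t)"
  proof (intro allI impI ballI)
    fix \<xi> s t
    assume lim: "limit_ordinal \<kappa> \<xi>" and st: "s \<in> level \<kappa> (Restr T S) \<xi>" "t \<in> level \<kappa> (Restr T S) \<xi>"
      and eq: "underS (Restr T S) s = underS (Restr T S) t"
    have "\<xi> \<in> Field \<kappa>" using lim unfolding limit_ordinal_def by simp
    then have "s \<in> S" "r s = a \<xi>" "t \<in> S" "r t = a \<xi>" using st sub_level by auto
    then show "s = t" using S_limit_unique[OF lim _ _ _ _ eq] by simp
  qed
qed

lemma strong_subtree_S: "strong_subtree \<kappa> T S"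
  unfolding strong_subtree_def
proof (intro conjI exI ballI)
  show "S \<subseteq> Field T" by (rule S_Field)
  show "nice_tree \<kappa> (Restr T S)" by (rule nice_S)
  show A: "A \<subseteq> Field \<kappa>" using A_Field by auto
  show "|A| =o \<kappa>" using unbounded_card[OF A A_unbounded] .
  show "iso \<kappa> (Restr \<kappa> A) a" by (rule iso_a)
  fix \<xi> assume \<xi>: "\<xi> \<in> Field \<kappa>"
  show "level \<kappa> (Restr T S) \<xi> \<subseteq> level \<kappa> T (a \<xi>)"
    unfolding sub_level[OF \<xi>] level_eq[OF A_Field[OF a_A[OF \<xi>]]] using S_Field by auto
  fix s u assume s: "s \<in> level \<kappa> (Restr T S) \<xi>" and u: "u \<in> Succ T s"
  then show "\<exists>!v. v \<in> level \<kappa> (Restr T S) (wo_rel.suc \<kappa> {\<xi>}) \<and> (u, v) \<in> T"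
    using sub_Succ_extension[OF \<xi> _ _ u] sub_level[OF \<xi>] by simp
qed

end

theorem theorem5p3:
  fixes \<kappa> :: "'a rel" and \<delta> :: 'a and T :: "'b rel" and f :: "'b \<Rightarrow> 'a"
  assumes "inaccessible \<kappa>"
    and "\<exists>I. ideal_on (Field \<kappa>) I \<and> complete_ideal \<kappa> I \<and> saturated_ideal \<kappa> I"
    and "\<delta> \<in> Field \<kappa>"
    and "nice_tree \<kappa> T"
    and "\<forall>t\<in>Field T. f t \<in> underS \<kappa> \<delta>"
  shows "\<exists>S. strong_subtree \<kappa> T S \<and> (\<exists>c. \<forall>t\<in>S. f t = c)"
proof -
  interpret regular_cardinal \<kappa>
    using assms(1) unfolding inaccessible_def by unfold_locales simp_all
  have "tree T" "\<And>t. t \<in> Field T \<Longrightarrow> ht T t <o \<kappa>"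
    using assms(4) unfolding nice_tree_def by simp_all
  then obtain r where r: "rank_function \<kappa> T r"
    using rank_function_exists[of T] by metis
  interpret nice_ranked_tree \<kappa> T r
    using r assms(4) by unfold_locales
  obtain I where I: "ideal_on (Field \<kappa>) I" "complete_ideal \<kappa> I" "saturated_ideal \<kappa> I"
    using assms(2) by auto
  interpret saturated_tree \<kappa> T r I f
    using I by unfold_locales
  obtain X t c where X: "X \<subseteq> Field \<kappa>" "X \<notin> I" "t \<in> Field T"
    "\<forall>s. (t, s) \<in> T \<longrightarrow> X - hits s c \<in> I"
    using ex_dense_colour[OF assms(3)] assms(5) by auto
  \<comment> \<open>This is the density from which the subtree is built; the ideal is not mentioned
    beyond it.\<close>
  have "\<exists>\<alpha>. \<beta> \<preceq> \<alpha> \<and> \<gamma> \<preceq> \<alpha> \<and>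
      (\<forall>u. (t, u) \<in> T \<and> r u = \<gamma> \<longrightarrow> (\<exists>v. (u, v) \<in> T \<and> r v = \<alpha> \<and> f v = c))"
    if \<beta>: "\<beta> \<in> Field \<kappa>" and \<gamma>: "\<gamma> \<in> Field \<kappa>" for \<beta> \<gamma>
  proof -
    define L where "L = {u \<in> Field T. r u = \<gamma> \<and> (t, u) \<in> T}"
    have "L \<subseteq> {u \<in> Field T. r u = \<gamma>}" unfolding L_def by auto
    then have "|L| <o \<kappa>" using ordLeq_ordLess_trans[OF card_of_mono1 card_level[OF \<gamma>]] by simp
    then have "(\<Union>u\<in>L. X - hits u c) \<in> I"
      by (rule null_UN) (use X(4) in \<open>simp add: L_def\<close>)
    \<comment> \<open>Everything unsuitable is null: the heights below \<beta> or \<gamma>, and for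
      each of the fewer than \<kappa> nodes \<open>u\<close> the part of \<open>X\<close> that
      \<open>u\<close> does not hit. The positive set \<open>X\<close> is not covered by it.\<close>
    then have "(underS \<kappa> \<beta> \<union> underS \<kappa> \<gamma>) \<union> (\<Union>u\<in>L. X - hits u c) \<in> I"
      using null_Un null_underS \<beta> \<gamma> by simp
    then have "\<not> X \<subseteq> (underS \<kappa> \<beta> \<union> underS \<kappa> \<gamma>) \<union> (\<Union>u\<in>L. X - hits u c)"
      using null_mono X(2) by blast
    then obtain \<alpha> where \<alpha>: "\<alpha> \<in> X" "\<not> \<alpha> \<prec> \<beta>" "\<not> \<alpha> \<prec> \<gamma>" "\<forall>u\<in>L. \<alpha> \<in> hits u c"
      by auto
    have \<alpha>F: "\<alpha> \<in> Field \<kappa>" using \<alpha>(1) X(1) by auto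
    have "\<exists>v. (u, v) \<in> T \<and> r v = \<alpha> \<and> f v = c" if "(t, u) \<in> T" "r u = \<gamma>" for u
    proof -
      have "u \<in> L" using that T_Field(2)[OF that(1)] unfolding L_def by simp
      then have "\<alpha> \<in> hits u c" using \<alpha>(4) by simp
      then show ?thesis unfolding hits_def by simp
    qed
    then show ?thesis
      using \<alpha>(2,3) not_less[OF \<alpha>F \<beta>] not_less[OF \<alpha>F \<gamma>] by (intro exI[of _ \<alpha>]) simp
  qed
  then interpret dense_colour_tree \<kappa> T r f c t
    using X(3) by unfold_locales
  show ?thesis
    using strong_subtree_S S_colour by (intro exI[of _ S] conjI exI[of _ c] ballI)
qed

end
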